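(* Let $P\not\equiv0$ and $Q$ be polynomials such that $Q/P$ has at most simple poles, and consider $$g''-\frac{P'}{P}g'+\frac QPg=0. \qquad( * )$$ Put $$R=\frac12\left(\frac{P''}{P}-\frac32\Bigl(\frac{P'}{P}\Bigr)^2\right)+\frac QP .$$ Then the following are equivalent: (i) there exist a local solution $g\not\equiv0$ of $( * )$ and a local primitive $G$ of $P/g^2$ which extends to a meromorphic function in $\mathbb C$; (ii) the meromorphic function $2R$ satisfies the Laine condition; (iii) every local solution of $( * )$ extends to an entire function $g$, and for every such $g\not\equiv0$ the differential $Pg^{-2}\,dz$ has a meromorphic primitive in $\mathbb C$.
   Context: Laine condition: for a meromorphic function $R$ in $\mathbb C$, "$2R$ satisfies the Laine condition" means that at every pole $z_0$ of $R$ the Laurent expansion has the form $$R(z)=\frac{1-m^2}{4(z-z_0)^2}+\frac{b_1}{z-z_0}+b_2+b_3(z-z_0)+\cdots$$ with an integer $m=m(z_0)\ge2$, and $\mathcal D_m(z_0)=0$, where $\mathcal D_m(z_0)$ is the determinant of the $m\times m$ matrix whose $j$-th row ($1\le j\le m$) has: for columns $i=1,\dots,m-1$, entry $b_{j-i}$ if $i<j$, entry $j^2-jm$ if $i=j$, and $0$ if $i>j$; and in the last column $i=m$ the entry $b_j$. For example $\mathcal D_2=\det\begin{pmatrix}-1&b_1\\ b_1&b_2\end{pmatrix}$. A local solution is an analytic solution near some point where $P\ne0$ (and, when forming $P/g^2$, $g\neq 0$). *)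

theory Defs
  imports
    "HOL-Complex_Analysis.Complex_Analysis"
    "Jordan_Normal_Form.Determinant"
begin

definition at_most_simple_poles :: "(complex \<Rightarrow> complex) \<Rightarrow> bool" where
  "at_most_simple_poles f \<longleftrightarrow> (\<forall>z. is_pole f z \<longrightarrow> zorder f z = -1)"

(* Rows and columns of JNF matrices are numbered from 0; j and i below are the 1-based
   row and column numbers. *)
definition laine_matrix :: "nat \<Rightarrow> (nat \<Rightarrow> complex) \<Rightarrow> complex mat" where
  "laine_matrix m b = mat m m (\<lambda>(r, c).
     let j = r + 1; i = c + 1 in
       if i = m then b j
       else if i < j then b (j - i)
       else if i = j then of_nat j ^ 2 - of_nat j * of_nat m
       else 0)"

definition laine_det :: "nat \<Rightarrow> (nat \<Rightarrow> complex) \<Rightarrow> complex" where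
  "laine_det m b = Determinant.det (laine_matrix m b)"

(* "2R satisfies the Laine condition", as a predicate on R.  F is the Laurent series of R
   at z0, and b k is its coefficient of (z - z0)^(k - 2). *)
definition double_satisfies_laine :: "(complex \<Rightarrow> complex) \<Rightarrow> bool" where
  "double_satisfies_laine R \<longleftrightarrow>
     (\<forall>z0. is_pole R z0 \<longrightarrow>
       (\<exists>(m::nat) F. m \<ge> 2 \<and>
          (\<lambda>w. R (z0 + w)) has_laurent_expansion F \<and>
          fls_subdegree F = -2 \<and>
          fls_nth F (-2) = (1 - of_nat m ^ 2) / 4 \<and>
          laine_det m (\<lambda>k. fls_nth F (int k - 2)) = 0))"

definition R_fun :: "complex poly \<Rightarrow> complex poly \<Rightarrow> complex \<Rightarrow> complex" where
  "R_fun P Q z =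
     1/2 * (poly (pderiv (pderiv P)) z / poly P z
            - 3/2 * (poly (pderiv P) z / poly P z) ^ 2)
     + poly Q z / poly P z"

definition local_solution ::
  "complex poly \<Rightarrow> complex poly \<Rightarrow> complex \<Rightarrow> real \<Rightarrow> (complex \<Rightarrow> complex) \<Rightarrow> bool" where
  "local_solution P Q a r g \<longleftrightarrow>
     r > 0 \<and> (\<forall>z\<in>ball a r. poly P z \<noteq> 0) \<and> g holomorphic_on ball a r \<and>
     (\<forall>z\<in>ball a r.
        deriv (deriv g) z - poly (pderiv P) z / poly P z * deriv g z
          + poly Q z / poly P z * g z = 0)"

definition local_primitive ::
  "complex poly \<Rightarrow> (complex \<Rightarrow> complex) \<Rightarrow> complex \<Rightarrow> real \<Rightarrow> (complex \<Rightarrow> complex) \<Rightarrow> bool" where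
  "local_primitive P g c s G \<longleftrightarrow>
     s > 0 \<and> (\<forall>z\<in>ball c s. g z \<noteq> 0) \<and>
     (\<forall>z\<in>ball c s. (G has_field_derivative poly P z / (g z) ^ 2) (at z))"

(* For entire g.  The derivative is prescribed off the zeros of g; if g is not identically zero
   these form a discrete set, so G' = P/g^2 holds as an identity of meromorphic functions. *)
definition has_meromorphic_primitive :: "complex poly \<Rightarrow> (complex \<Rightarrow> complex) \<Rightarrow> bool" where
  "has_meromorphic_primitive P g \<longleftrightarrow>
     (\<exists>G. G meromorphic_on UNIV \<and>
        (\<forall>z. g z \<noteq> 0 \<longrightarrow> (G has_field_derivative poly P z / (g z) ^ 2) (at z)))"

definition extends_from_ball ::
  "(complex \<Rightarrow> complex) \<Rightarrow> complex \<Rightarrow> real \<Rightarrow> (complex \<Rightarrow> complex) \<Rightarrow> bool" where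
  "extends_from_ball f a r g \<longleftrightarrow> (\<forall>z\<in>ball a r. f z = g z)"

end

theory Submission imports Defs begin

text \<open>
  All three conditions are equivalent to a local one: at every point \<open>p\<close> the equation has an
  analytic solution that does not vanish at \<open>p\<close>. By the Frobenius method such a solution exists iff the
  recurrence for its coefficients, which degenerates at the difference \<open>m\<close> of the exponents, can be
  solved up to the index \<open>m\<close>; this is the vanishing of the Laine determinant.

  Given a nonvanishing solution \<open>g\<close> near \<open>p\<close>, the product of \<open>g\<close> with a primitive of \<open>P / g^2\<close> is a second
  solution with Wronskian \<open>P\<close>, so all solutions extend across \<open>p\<close> and become entire; the quotient of two
  solutions with Wronskian \<open>P\<close> is the required meromorphic primitive.

  Conversely, let \<open>G\<close> be a meromorphic primitive of \<open>P / g^2\<close>. Its Schwarzian derivative is \<open>2 R\<close>, which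
  forces the order of \<open>G'\<close> at a point \<open>p\<close> that is not a pole of \<open>G\<close> to agree with the order of \<open>P\<close>, so that
  a square root of \<open>P / G'\<close> is a nonvanishing solution at \<open>p\<close>. At a pole, \<open>G\<close> is replaced by \<open>- 1 / G\<close>.
\<close>

section \<open>Solutions and Wronskians\<close>

text \<open>The equation multiplied by \<open>P\<close>, so that it also makes sense at the zeros of
  \<open>P\<close> and stays holomorphic there.\<close>

definition ode_op ::
  "complex poly \<Rightarrow> complex poly \<Rightarrow> (complex \<Rightarrow> complex) \<Rightarrow> complex \<Rightarrow> complex" where
  "ode_op P Q g z =
     poly P z * deriv (deriv g) z - poly (pderiv P) z * deriv g z + poly Q z * g z"

text \<open>If \<open>P\<close> has order \<open>n\<close> at \<open>p\<close>, the exponents of the equation there are \<open>0\<close> and \<open>n + 1\<close>, and a solution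
  with exponent \<open>0\<close> exists iff no logarithm occurs.\<close>

definition unit_solution_at :: "complex poly \<Rightarrow> complex poly \<Rightarrow> complex \<Rightarrow> bool" where
  "unit_solution_at P Q p \<longleftrightarrow>
     (\<exists>g. g analytic_on {p} \<and> g p \<noteq> 0 \<and> (\<forall>\<^sub>F z in nhds p. ode_op P Q g z = 0))"

lemma holomorphic_on_ode_op [holomorphic_intros]:
  "g holomorphic_on S \<Longrightarrow> open S \<Longrightarrow> ode_op P Q g holomorphic_on S"
  unfolding ode_op_def by (intro holomorphic_intros) auto

lemma ode_op_cong:
  assumes "open S" "\<And>w. w \<in> S \<Longrightarrow> f w = g w" "z \<in> S"
  shows "ode_op P Q f z = ode_op P Q g z"
proof -
  have ev: "\<forall>\<^sub>F w in nhds z. f w = g w"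
    using assms eventually_nhds by blast
  then have "deriv f z = deriv g z" "deriv (deriv f) z = deriv (deriv g) z"
    using higher_deriv_cong_ev[OF ev refl, of 1] higher_deriv_cong_ev[OF ev refl, of 2]
    by (simp_all add: numeral_2_eq_2)
  then show ?thesis using assms by (simp add: ode_op_def)
qed

lemma deriv_eqI_open:
  assumes "open S" "\<And>w. w \<in> S \<Longrightarrow> (f has_field_derivative f' w) (at w)" "z \<in> S"
    and "(f' has_field_derivative d) (at z)"
  shows "deriv f z = f' z" "deriv (deriv f) z = d"
proof -
  show "deriv f z = f' z" using assms DERIV_imp_deriv by blast
  have "\<forall>\<^sub>F w in nhds z. deriv f w = f' w"
    unfolding eventually_nhds using assms DERIV_imp_deriv by blast
  then have "deriv (deriv f) z = deriv f' z" by (rule deriv_cong_ev) simp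
  then show "deriv (deriv f) z = d" using DERIV_imp_deriv[OF assms(4)] by simp
qed

lemma holomorphic_has_derivs:
  assumes "f holomorphic_on S" "open S" "z \<in> S"
  shows "(f has_field_derivative deriv f z) (at z)"
    and "(deriv f has_field_derivative deriv (deriv f) z) (at z)"
  using assms holomorphic_derivI[OF assms] holomorphic_derivI[OF holomorphic_deriv[OF assms(1,2)] assms(2,3)]
  by auto

lemma deriv_lincomb:
  assumes "f holomorphic_on S" "g holomorphic_on S" "open S" "z \<in> S"
  shows "deriv (\<lambda>w. c * f w + d * g w) z = c * deriv f z + d * deriv g z"
  using assms by (intro DERIV_imp_deriv) (auto intro!: derivative_eq_intros holomorphic_has_derivs)

lemma eventually_nhds_ballI:
  assumes "e > 0" "\<And>z. z \<in> ball p e \<Longrightarrow> R z"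
  shows "\<forall>\<^sub>F z in nhds p. R z"
  unfolding eventually_nhds using assms by (intro exI[of _ "ball p e"]) auto

lemma open_nonroots:
  fixes P :: "complex poly"
  shows "open S \<Longrightarrow> open {z \<in> S. poly P z \<noteq> 0}"
proof -
  assume "open S"
  have "open {z. poly P z \<noteq> 0}"
    by (intro open_Collect_neq continuous_intros)
  then have "open (S \<inter> {z. poly P z \<noteq> 0})" using \<open>open S\<close> by blast
  moreover have "S \<inter> {z. poly P z \<noteq> 0} = {z \<in> S. poly P z \<noteq> 0}" by blast
  ultimately show ?thesis by simp
qed

lemma nonroot_exists:
  fixes P :: "complex poly"
  assumes "open S" "S \<noteq> {}" "P \<noteq> 0"
  obtains z where "z \<in> S" "poly P z \<noteq> 0"
proof -
  have "infinite S" using assms(1,2) finite_imp_not_open by blast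
  moreover have "finite {z. poly P z = 0}" using assms(3) by (rule poly_roots_finite)
  ultimately have "\<not> S \<subseteq> {z. poly P z = 0}" using finite_subset by blast
  then show thesis using that by blast
qed

text \<open>Abel's identity. In \<open>f\<close> times the equation for \<open>g\<close> minus
  \<open>g\<close> times the equation for \<open>f\<close> the \<open>Q\<close> terms cancel,
  leaving \<open>P W' = P' W\<close>, so \<open>W / P\<close> is constant near a nonroot of
  \<open>P\<close>. The identity theorem carries \<open>W = \<alpha> P\<close> over the whole
  connected set, zeros of \<open>P\<close> included.\<close>

lemma wronskian_eq:
  assumes f: "f holomorphic_on S" and g: "g holomorphic_on S" and S: "open S" "connected S"
    and "P \<noteq> 0" and "\<And>z. z \<in> S \<Longrightarrow> ode_op P Q f z = 0" "\<And>z. z \<in> S \<Longrightarrow> ode_op P Q g z = 0"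
  obtains \<alpha> where "\<And>z. z \<in> S \<Longrightarrow> f z * deriv g z - deriv f z * g z = \<alpha> * poly P z"
proof (cases "S = {}")
  case False
  then obtain q where q: "q \<in> S" "poly P q \<noteq> 0"
    using nonroot_exists S(1) \<open>P \<noteq> 0\<close> by blast
  then obtain e where e: "e > 0" "ball q e \<subseteq> {z \<in> S. poly P z \<noteq> 0}"
    using open_nonroots[OF S(1), of P] by (auto simp: open_contains_ball)
  define W where "W z = f z * deriv g z - deriv f z * g z" for z
  have "\<exists>\<alpha>. \<forall>z\<in>ball q e. W z / poly P z = \<alpha>"
  proof (rule has_field_derivative_zero_constant)
    fix z assume "z \<in> ball q e"
    then have z: "z \<in> S" "poly P z \<noteq> 0" using e by auto
    let ?w = "f z * deriv (deriv g) z - deriv (deriv f) z * g z"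
    have W': "(W has_field_derivative ?w) (at z)"
      unfolding W_def using f g S z
      by (auto intro!: derivative_eq_intros holomorphic_has_derivs)
    have "poly P z * ?w = poly (pderiv P) z * W z"
    proof -
      have "poly P z * ?w - poly (pderiv P) z * W z = f z * ode_op P Q g z - g z * ode_op P Q f z"
        by (simp add: ode_op_def W_def algebra_simps)
      then show ?thesis using assms z by simp
    qed
    then have "((\<lambda>z. W z / poly P z) has_field_derivative 0) (at z)"
      using z by (auto intro!: derivative_eq_intros W' poly_DERIV simp: field_simps)
    then show "((\<lambda>z. W z / poly P z) has_field_derivative 0) (at z within ball q e)"
      by (rule has_field_derivative_at_within)
  qed simp
  then obtain \<alpha> where \<alpha>: "\<And>z. z \<in> ball q e \<Longrightarrow> W z / poly P z = \<alpha>" by blast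
  have "W z = \<alpha> * poly P z" if "z \<in> S" for z
  proof (rule analytic_continuation_open[of "ball q e" S W "\<lambda>z. \<alpha> * poly P z"])
    show "W holomorphic_on S" unfolding W_def using f g S by (intro holomorphic_intros)
    show "(\<lambda>z. \<alpha> * poly P z) holomorphic_on S" by (intro holomorphic_intros)
    show "W z = \<alpha> * poly P z" if "z \<in> ball q e" for z
      using \<alpha>[OF that] that e by (auto simp: field_simps)
  qed (use e S that in auto)
  then show thesis using that[of \<alpha>] unfolding W_def by blast
qed (use that in blast)

text \<open>Cramer's rule. The Wronskians of \<open>f\<close> with \<open>g1\<close> and
  \<open>g2\<close> are constant multiples of \<open>P\<close>, and the determinant of the system is
  \<open>P\<close>, so the coefficients are constants. Division by \<open>P\<close> works off its
  zeros; the identity theorem fills these in.\<close>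

lemma solution_in_span:
  assumes hol: "f holomorphic_on S" "g1 holomorphic_on S" "g2 holomorphic_on S"
    and S: "open S" "connected S" "P \<noteq> 0"
    and ode: "\<And>z. z \<in> S \<Longrightarrow> ode_op P Q f z = 0" "\<And>z. z \<in> S \<Longrightarrow> ode_op P Q g1 z = 0"
      "\<And>z. z \<in> S \<Longrightarrow> ode_op P Q g2 z = 0"
    and W: "\<And>z. z \<in> S \<Longrightarrow> g1 z * deriv g2 z - deriv g1 z * g2 z = poly P z"
  obtains c d where "\<And>z. z \<in> S \<Longrightarrow> f z = c * g1 z + d * g2 z"
proof (cases "S = {}")
  case False
  obtain \<alpha> where \<alpha>: "\<And>z. z \<in> S \<Longrightarrow> f z * deriv g1 z - deriv f z * g1 z = \<alpha> * poly P z"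
    using wronskian_eq[OF hol(1,2) S ode(1,2)] by metis
  obtain \<beta> where \<beta>: "\<And>z. z \<in> S \<Longrightarrow> f z * deriv g2 z - deriv f z * g2 z = \<beta> * poly P z"
    using wronskian_eq[OF hol(1,3) S ode(1,3)] by metis
  have P: "poly P z * f z = poly P z * (\<beta> * g1 z + (- \<alpha>) * g2 z)" if "z \<in> S" for z
  proof -
    have "poly P z * f z = (g1 z * deriv g2 z - deriv g1 z * g2 z) * f z" using W that by simp
    also have "\<dots> = g1 z * (f z * deriv g2 z - deriv f z * g2 z) - g2 z * (f z * deriv g1 z - deriv f z * g1 z)"
      by (simp add: algebra_simps)
    also have "\<dots> = poly P z * (\<beta> * g1 z + (- \<alpha>) * g2 z)"
      unfolding \<alpha>[OF that] \<beta>[OF that] by (simp add: algebra_simps)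
    finally show ?thesis .
  qed
  have "f z = \<beta> * g1 z + (- \<alpha>) * g2 z" if "z \<in> S" for z
  proof (rule analytic_continuation_open[of "{z \<in> S. poly P z \<noteq> 0}" S f "\<lambda>z. \<beta> * g1 z + (- \<alpha>) * g2 z"])
    show "{z \<in> S. poly P z \<noteq> 0} \<noteq> {}"
      using nonroot_exists[OF S(1) False S(3)] by blast
    show "f z = \<beta> * g1 z + (- \<alpha>) * g2 z" if "z \<in> {z \<in> S. poly P z \<noteq> 0}" for z
      using P[of z] that by simp
    show "(\<lambda>z. \<beta> * g1 z + (- \<alpha>) * g2 z) holomorphic_on S"
      by (intro holomorphic_intros hol)
  qed (use S hol that open_nonroots in auto)
  then show thesis using that by blast
qed (use that in blast)

section \<open>Nonvanishing local solutions and reduction of order\<close>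

lemma unit_solution_atE:
  assumes "unit_solution_at P Q p"
  obtains e g where "e > 0" "g holomorphic_on ball p e" "\<And>z. z \<in> ball p e \<Longrightarrow> g z \<noteq> 0"
    "\<And>z. z \<in> ball p e \<Longrightarrow> ode_op P Q g z = 0"
proof -
  obtain g where g: "g analytic_on {p}" "g p \<noteq> 0" "\<forall>\<^sub>F z in nhds p. ode_op P Q g z = 0"
    using assms unfolding unit_solution_at_def by blast
  obtain r where r: "r > 0" "g holomorphic_on ball p r"
    using g(1) by (auto simp: analytic_at_ball)
  have "\<forall>\<^sub>F z in nhds p. g z \<noteq> 0"
    using analytic_at_neq_imp_eventually_neq[OF g(1,2)] g(2) eventually_nhds_conv_at by blast
  then have "\<forall>\<^sub>F z in nhds p. g z \<noteq> 0 \<and> ode_op P Q g z = 0 \<and> z \<in> ball p r"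
    using g(3) r(1) by (intro eventually_conj eventually_nhds_in_open) auto
  then obtain e where "e > 0" "\<And>z. dist z p < e \<Longrightarrow> g z \<noteq> 0 \<and> ode_op P Q g z = 0 \<and> z \<in> ball p r"
    unfolding eventually_nhds_metric by blast
  then have e: "e > 0" "\<And>z. z \<in> ball p e \<Longrightarrow> g z \<noteq> 0 \<and> ode_op P Q g z = 0 \<and> z \<in> ball p r"
    by (auto simp: dist_commute)
  then have "g holomorphic_on ball p e"
    by (intro holomorphic_on_subset[OF r(2)]) blast
  then show thesis using that e by blast
qed

text \<open>Reduction of order: the operator maps \<open>g K\<close> to \<open>K\<close> times its
  value at \<open>g\<close>, and the Wronskian is \<open>g^2 K' = P\<close>. The primitive
  \<open>K\<close> is left arbitrary because the lemma is applied also to a prescribed meromorphic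
  primitive.\<close>

lemma second_solution:
  assumes S: "open S" and hol: "g holomorphic_on S" and nz: "\<And>z. z \<in> S \<Longrightarrow> g z \<noteq> 0"
    and ode: "\<And>z. z \<in> S \<Longrightarrow> ode_op P Q g z = 0"
    and K: "\<And>z. z \<in> S \<Longrightarrow> (K has_field_derivative poly P z / (g z)\<^sup>2) (at z)"
  shows "(\<lambda>z. g z * K z) holomorphic_on S"
    and "\<And>z. z \<in> S \<Longrightarrow> ode_op P Q (\<lambda>z. g z * K z) z = 0"
    and "\<And>z. z \<in> S \<Longrightarrow> g z * deriv (\<lambda>z. g z * K z) z - deriv g z * (g z * K z) = poly P z"
proof -
  have "K holomorphic_on S"
    using K S by (metis holomorphic_on_open)
  then show "(\<lambda>z. g z * K z) holomorphic_on S"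
    by (intro holomorphic_intros hol)
  note gD = holomorphic_has_derivs[OF hol S]
  have 1: "((\<lambda>z. g z * K z) has_field_derivative deriv g z * K z + poly P z / g z) (at z)"
    if "z \<in> S" for z
    using that nz by (auto intro!: derivative_eq_intros K gD simp: field_simps power2_eq_square)
  have 2: "((\<lambda>z. deriv g z * K z + poly P z / g z) has_field_derivative
        deriv (deriv g) z * K z + poly (pderiv P) z / g z) (at z)"
    if "z \<in> S" for z
    using that nz by (auto intro!: derivative_eq_intros K gD poly_DERIV simp: field_simps power2_eq_square)
  have D: "deriv (\<lambda>z. g z * K z) z = deriv g z * K z + poly P z / g z"
    "deriv (deriv (\<lambda>z. g z * K z)) z = deriv (deriv g) z * K z + poly (pderiv P) z / g z"
    if "z \<in> S" for z
    using deriv_eqI_open[OF S _ that 2[OF that]] 1 by blast+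
  fix z assume z: "z \<in> S"
  have "ode_op P Q (\<lambda>z. g z * K z) z = K z * ode_op P Q g z"
    using nz[OF z] unfolding ode_op_def D[OF z] by (simp add: field_simps)
  then show "ode_op P Q (\<lambda>z. g z * K z) z = 0" using ode[OF z] by simp
  show "g z * deriv (\<lambda>z. g z * K z) z - deriv g z * (g z * K z) = poly P z"
    using nz[OF z] unfolding D[OF z] by (simp add: field_simps)
qed

text \<open>A ball is convex, so \<open>P / g^2\<close> has a primitive there. The Wronskian is
  \<open>P\<close> itself, hence the pair spans all solutions near \<open>p\<close> even if
  \<open>P\<close> vanishes at \<open>p\<close>.\<close>

lemma local_basis:
  assumes "unit_solution_at P Q p"
  obtains e g1 g2 where "e > 0" "g1 holomorphic_on ball p e" "g2 holomorphic_on ball p e"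
    "\<And>z. z \<in> ball p e \<Longrightarrow> ode_op P Q g1 z = 0" "\<And>z. z \<in> ball p e \<Longrightarrow> ode_op P Q g2 z = 0"
    "\<And>z. z \<in> ball p e \<Longrightarrow> g1 z * deriv g2 z - deriv g1 z * g2 z = poly P z"
proof -
  obtain e g where e: "e > 0" and hol: "g holomorphic_on ball p e"
    and nz: "\<And>z. z \<in> ball p e \<Longrightarrow> g z \<noteq> 0" and ode: "\<And>z. z \<in> ball p e \<Longrightarrow> ode_op P Q g z = 0"
    using unit_solution_atE[OF assms] by metis
  have hol': "(\<lambda>z. poly P z / (g z)\<^sup>2) holomorphic_on ball p e"
    using hol nz by (intro holomorphic_intros) auto
  obtain K where K0: "\<And>z. z \<in> ball p e \<Longrightarrow>
      (K has_field_derivative poly P z / (g z)\<^sup>2) (at z within ball p e)"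
    using holomorphic_convex_primitive'[OF convex_ball open_ball hol'] by metis
  from K0 have K: "(K has_field_derivative poly P z / (g z)\<^sup>2) (at z)" if "z \<in> ball p e" for z
    using that at_within_open[OF that open_ball] by metis
  show thesis
    by (rule that[OF e hol _ ode]) (use second_solution[OF open_ball hol nz ode K] in auto)
qed

section \<open>Continuation to entire solutions\<close>

lemma ball_subset_of_cball_cover:
  fixes a :: complex
  assumes "\<rho> > 0" "e > 0" "(\<Union>x\<in>cball a \<rho>. ball x e) \<subseteq> U"
  shows "ball a (\<rho> + e) \<subseteq> U"
proof
  fix z assume z: "z \<in> ball a (\<rho> + e)"
  show "z \<in> U"
  proof (cases "z \<in> cball a \<rho>")
    case True
    then show ?thesis using assms by force
  next
    case False
    define d where "d = norm (z - a)"
    have d: "\<rho> < d" "d < \<rho> + e" using False z by (auto simp: d_def dist_norm norm_minus_commute)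
    \<comment> \<open>The radial projection of \<open>z\<close> onto the sphere of radius
      \<open>\<rho>\<close>.\<close>
    let ?x = "a + of_real (\<rho> / d) * (z - a)"
    have "z \<noteq> a" using d assms(1) by (auto simp: d_def)
    then have "norm (?x - a) = \<rho>"
      using d assms(1) by (simp add: norm_mult norm_divide d_def)
    then have xD: "?x \<in> cball a \<rho>" by (simp add: dist_norm norm_minus_commute)
    have zx: "z - ?x = of_real (1 - \<rho> / d) * (z - a)"
      by (simp add: algebra_simps)
    have "norm (z - ?x) = \<bar>1 - \<rho> / d\<bar> * d"
      unfolding zx norm_mult norm_of_real by (simp only: d_def)
    moreover have "\<bar>1 - \<rho> / d\<bar> * d = d - \<rho>" using d assms(1) by (simp add: abs_if field_simps)
    ultimately have "norm (z - ?x) = d - \<rho>" by simp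
    then have "z \<in> ball ?x e" using d by (simp add: dist_norm norm_minus_commute)
    then show ?thesis using assms(3) xD by blast
  qed
qed

text \<open>The local extensions are glued. Any two agree on the overlap of their balls, since a
  nonempty overlap is convex and meets the open disc, where both equal \<open>f\<close>. Compactness
  of the closed disc then yields a uniform margin beyond it.\<close>

lemma holomorphic_extend_beyond_sphere:
  assumes f: "f holomorphic_on ball a \<rho>" and \<rho>: "\<rho> > 0"
    and ext: "\<And>p. p \<in> sphere a \<rho> \<Longrightarrow>
      \<exists>e>0. \<exists>h. h holomorphic_on ball p e \<and> (\<forall>z\<in>ball p e \<inter> ball a \<rho>. h z = f z)"
  obtains \<rho>' F where "\<rho>' > \<rho>" "F holomorphic_on ball a \<rho>'" "\<And>z. z \<in> ball a \<rho> \<Longrightarrow> F z = f z"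
proof -
  obtain e h where e: "\<And>p. p \<in> sphere a \<rho> \<Longrightarrow> e p > 0"
    and h: "\<And>p. p \<in> sphere a \<rho> \<Longrightarrow> h p holomorphic_on ball p (e p)"
    and hf: "\<And>p z. p \<in> sphere a \<rho> \<Longrightarrow> z \<in> ball p (e p) \<Longrightarrow> z \<in> ball a \<rho> \<Longrightarrow> h p z = f z"
    using ext by (metis IntI)
  define U where "U = ball a \<rho> \<union> (\<Union>p\<in>sphere a \<rho>. ball p (e p))"
  define s where "s z = (SOME p. p \<in> sphere a \<rho> \<and> z \<in> ball p (e p))" for z
  define F where "F z = (if z \<in> ball a \<rho> then f z else h (s z) z)" for z
  have agree: "h p z = h q z"
    if p: "p \<in> sphere a \<rho>" "z \<in> ball p (e p)" and q: "q \<in> sphere a \<rho>" "z \<in> ball q (e q)" for p q z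
  proof -
    let ?D = "cball a \<rho>" and ?S = "ball p (e p) \<inter> ball q (e q)"
    \<comment> \<open>The projection onto the closed disc does not increase distances to p and q.\<close>
    define x where "x = closest_point ?D z"
    have xD: "x \<in> ?D" unfolding x_def using \<rho> by (intro closest_point_in_set) auto
    have "dist x p \<le> dist z p" if "p \<in> sphere a \<rho>" for p
      using closest_point_lipschitz[of ?D z p] closest_point_self[of p ?D] that \<rho>
      by (auto simp: x_def)
    from this[OF p(1)] this[OF q(1)] have "x \<in> ?S"
      using p q by (auto simp: dist_commute)
    \<comment> \<open>\<open>x\<close> may lie on the bounding circle, but an open set meeting the
      closure of the disc meets the disc itself.\<close>
    moreover have "x \<in> closure (ball a \<rho>)" using xD \<rho> by simp
    ultimately have ne: "?S \<inter> ball a \<rho> \<noteq> {}"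
      using open_Int_closure_eq_empty[of ?S "ball a \<rho>"] by blast
    show ?thesis
    proof (rule analytic_continuation_open[of "?S \<inter> ball a \<rho>" ?S "h p" "h q"])
      show "connected ?S" by (intro convex_connected convex_Int) auto
      show "h p holomorphic_on ?S" "h q holomorphic_on ?S"
        using h p q by (auto intro: holomorphic_on_subset)
      show "h p z = h q z" if "z \<in> ?S \<inter> ball a \<rho>" for z
        using hf[OF p(1), of z] hf[OF q(1), of z] that by auto
    qed (use ne p q in auto)
  qed
  have F_h: "F z = h p z" if p: "p \<in> sphere a \<rho>" "z \<in> ball p (e p)" for p z
  proof (cases "z \<in> ball a \<rho>")
    case False
    have "s z \<in> sphere a \<rho> \<and> z \<in> ball (s z) (e (s z))"
      unfolding s_def by (rule someI) (use p in blast)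
    then show ?thesis using agree[of "s z" z p] p False by (simp add: F_def)
  qed (use hf[OF p] in \<open>simp add: F_def\<close>)
  have "F holomorphic_on U"
    unfolding U_def
  proof (intro holomorphic_on_Un holomorphic_on_UN_open)
    show "F holomorphic_on ball a \<rho>"
      using f by (rule holomorphic_transform) (simp add: F_def)
    show "F holomorphic_on ball p (e p)" if "p \<in> sphere a \<rho>" for p
      using h[OF that] by (rule holomorphic_transform) (use F_h[OF that] in simp)
  qed auto
  moreover have "open U" unfolding U_def by blast
  moreover have "cball a \<rho> \<subseteq> U"
  proof
    fix z assume "z \<in> cball a \<rho>"
    then have "z \<in> ball a \<rho> \<or> z \<in> sphere a \<rho>" by auto
    then show "z \<in> U" using e by (force simp: U_def)
  qed
  then obtain d where d: "d > 0" "(\<Union>x\<in>cball a \<rho>. ball x d) \<subseteq> U"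
    using compact_subset_open_imp_ball_epsilon_subset[OF compact_cball \<open>open U\<close>] by blast
  then have "ball a (\<rho> + d) \<subseteq> U" using \<rho> by (rule_tac ball_subset_of_cball_cover)
  ultimately show thesis
    using that[of "\<rho> + d" F] d by (auto simp: F_def intro: holomorphic_on_subset)
qed

text \<open>The extension is the sum of the Taylor series at \<open>a\<close>. Were its radius of
  convergence finite, continuation across every point of that circle would give a larger disc. The
  radius is not known beforehand, so the hypothesis covers every disc of radius at least
  \<open>r\<close>.\<close>

lemma holomorphic_extend_entire:
  assumes f: "f holomorphic_on ball a r" and r: "r > 0"
    and ext: "\<And>\<rho> F p. \<rho> \<ge> r \<Longrightarrow> F holomorphic_on ball a \<rho> \<Longrightarrow> (\<And>z. z \<in> ball a r \<Longrightarrow> F z = f z) \<Longrightarrow>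
      p \<in> sphere a \<rho> \<Longrightarrow>
      \<exists>e>0. \<exists>h. h holomorphic_on ball p e \<and> (\<forall>z\<in>ball p e \<inter> ball a \<rho>. h z = F z)"
  obtains h where "h holomorphic_on UNIV" "\<And>z. z \<in> ball a r \<Longrightarrow> h z = f z"
proof -
  define T where "T = fps_expansion f a"
  define R where "R = fps_conv_radius T"
  define h where "h z = eval_fps T (z - a)" for z
  have Rr: "ereal r \<le> R"
    unfolding R_def T_def using f by (intro conv_radius_fps_expansion) auto
  have hf: "h z = f z" if "z \<in> ball a r" for z
    unfolding h_def T_def
    using eval_fps_expansion'[of f a r "z - a"] f that
    by (auto simp: dist_norm norm_minus_commute)
  have hol: "h holomorphic_on eball a R"
  proof -
    have "(\<lambda>z. z - a) ` eball a R \<subseteq> eball 0 (fps_conv_radius T)"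
      by (auto simp: R_def in_eball_iff dist_norm norm_minus_commute)
    then have "eval_fps T \<circ> (\<lambda>z. z - a) holomorphic_on eball a R"
      by (intro holomorphic_on_compose_gen[OF _ holomorphic_on_eval_fps[OF order_refl]] holomorphic_intros)
    then show ?thesis by (simp add: o_def h_def[abs_def])
  qed
  have "R = \<infinity>"
  proof (rule ccontr)
    assume "R \<noteq> \<infinity>"
    then obtain \<rho> where \<rho>: "R = ereal \<rho>" using Rr by (cases R) auto
    then have "\<rho> \<ge> r" using Rr by simp
    have hol': "h holomorphic_on ball a \<rho>" using hol \<rho> by simp
    obtain \<rho>' F where F: "\<rho>' > \<rho>" "F holomorphic_on ball a \<rho>'" "\<And>z. z \<in> ball a \<rho> \<Longrightarrow> F z = h z"
      using holomorphic_extend_beyond_sphere[OF hol' _ ext[OF \<open>\<rho> \<ge> r\<close> hol' hf]] r \<open>\<rho> \<ge> r\<close>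
      by (metis order_less_le_trans)
    \<comment> \<open>\<open>F\<close> and \<open>f\<close> have the same germ at \<open>a\<close>,
      hence the same Taylor series, but \<open>F\<close> forces its radius to be at least
      \<open>\<rho>' > \<rho>\<close>.\<close>
    have "\<forall>\<^sub>F z in nhds a. F z = f z"
    proof -
      have "\<forall>\<^sub>F z in nhds a. z \<in> ball a r" using r by (intro eventually_nhds_in_open) auto
      then show ?thesis by eventually_elim (use F(3) hf \<open>\<rho> \<ge> r\<close> in auto)
    qed
    then have "fps_expansion F a = T"
      unfolding T_def by (intro fps_expansion_cong) auto
    moreover have "ereal \<rho>' \<le> fps_conv_radius (fps_expansion F a)"
      using F(2) by (intro conv_radius_fps_expansion) auto
    ultimately show False using F(1) \<rho> by (simp add: R_def)
  qed
  then have "h holomorphic_on UNIV" using hol by simp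
  then show thesis using that hf by blast
qed

section \<open>Global solutions and their quotients\<close>

text \<open>At a boundary point \<open>p\<close> of a disc a local basis lives on a full ball around
  \<open>p\<close>. Inside the disc the solution is a combination of this basis, and that
  combination continues it across \<open>p\<close>, zeros of \<open>P\<close> included.\<close>

lemma solution_extends:
  assumes unit: "\<And>p. unit_solution_at P Q p" and "P \<noteq> 0"
    and f: "f holomorphic_on ball a r" "r > 0" and ode: "\<And>z. z \<in> ball a r \<Longrightarrow> ode_op P Q f z = 0"
  obtains h where "h holomorphic_on UNIV" "\<And>z. z \<in> ball a r \<Longrightarrow> h z = f z"
proof (rule holomorphic_extend_entire[OF f])
  fix \<rho> F p assume \<rho>: "\<rho> \<ge> r" and F: "F holomorphic_on ball a \<rho>"
    and Ff: "\<And>z. z \<in> ball a r \<Longrightarrow> F z = f z" and p: "p \<in> sphere a \<rho>"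
  \<comment> \<open>The equation persists from the initial ball to the larger disc by the identity
    theorem.\<close>
  have odeF: "ode_op P Q F z = 0" if "z \<in> ball a \<rho>" for z
  proof (rule analytic_continuation_open[of "ball a r" "ball a \<rho>" "ode_op P Q F" "\<lambda>_. 0"])
    show "ode_op P Q F w = 0" if "w \<in> ball a r" for w
      using ode_op_cong[OF open_ball Ff that] ode[OF that] by simp
  qed (use \<rho> F f(2) that in \<open>auto intro!: holomorphic_intros\<close>)
  obtain e g1 g2 where e: "e > 0" and g: "g1 holomorphic_on ball p e" "g2 holomorphic_on ball p e"
    "\<And>z. z \<in> ball p e \<Longrightarrow> ode_op P Q g1 z = 0" "\<And>z. z \<in> ball p e \<Longrightarrow> ode_op P Q g2 z = 0"
    "\<And>z. z \<in> ball p e \<Longrightarrow> g1 z * deriv g2 z - deriv g1 z * g2 z = poly P z"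
    using local_basis[OF unit] by metis
  let ?S = "ball p e \<inter> ball a \<rho>"
  have S: "open ?S" "connected ?S" by (simp_all add: convex_connected convex_Int open_Int)
  have hol: "F holomorphic_on ?S" "g1 holomorphic_on ?S" "g2 holomorphic_on ?S"
    using F g by (auto intro: holomorphic_on_subset)
  obtain c d where cd: "\<And>z. z \<in> ?S \<Longrightarrow> F z = c * g1 z + d * g2 z"
    by (rule solution_in_span[OF hol S \<open>P \<noteq> 0\<close>, of Q]) (use odeF g in auto)
  have "(\<lambda>z. c * g1 z + d * g2 z) holomorphic_on ball p e"
    by (intro holomorphic_intros g)
  then show "\<exists>e>0. \<exists>h. h holomorphic_on ball p e \<and> (\<forall>z\<in>ball p e \<inter> ball a \<rho>. h z = F z)"
    using e cd by (intro exI[of _ e] exI[of _ "\<lambda>z. c * g1 z + d * g2 z"]) auto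
qed (use that in blast)

lemma solution_on_UNIV:
  assumes "h holomorphic_on UNIV" "open S" "S \<noteq> {}" "\<And>z. z \<in> S \<Longrightarrow> ode_op P Q h z = 0"
  shows "ode_op P Q h z = 0"
  by (rule analytic_continuation_open[of S UNIV "ode_op P Q h" "\<lambda>_. 0"])
    (use assms in \<open>auto intro!: holomorphic_intros\<close>)

text \<open>A second solution \<open>k\<close> is chosen so that \<open>h\<close> and
  \<open>k\<close> have Wronskian \<open>P\<close>; then \<open>(k / h)' = P / h^2\<close>, and
  \<open>k / h\<close> is a quotient of entire functions.\<close>

lemma solution_has_primitive:
  assumes unit: "\<And>p. unit_solution_at P Q p" and "P \<noteq> 0"
    and h: "h holomorphic_on UNIV" "\<And>z. ode_op P Q h z = 0" "h z0 \<noteq> 0"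
  shows "has_meromorphic_primitive P h"
proof -
  obtain e g1 g2 where e: "e > 0" and g: "g1 holomorphic_on ball 0 e" "g2 holomorphic_on ball 0 e"
    "\<And>z. z \<in> ball 0 e \<Longrightarrow> ode_op P Q g1 z = 0" "\<And>z. z \<in> ball 0 e \<Longrightarrow> ode_op P Q g2 z = 0"
    "\<And>z. z \<in> ball 0 e \<Longrightarrow> g1 z * deriv g2 z - deriv g1 z * g2 z = poly P z"
    using local_basis[OF unit] by metis
  obtain E1 where E1: "E1 holomorphic_on UNIV" "\<And>z. z \<in> ball 0 e \<Longrightarrow> E1 z = g1 z"
    using solution_extends[OF unit \<open>P \<noteq> 0\<close> g(1) e g(3)] by metis
  obtain E2 where E2: "E2 holomorphic_on UNIV" "\<And>z. z \<in> ball 0 e \<Longrightarrow> E2 z = g2 z"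
    using solution_extends[OF unit \<open>P \<noteq> 0\<close> g(2) e g(4)] by metis
  have ne: "ball (0::complex) e \<noteq> {}" using e by simp
  have "ode_op P Q E1 z = 0" "ode_op P Q E2 z = 0" if "z \<in> ball 0 e" for z
    using ode_op_cong[of "ball 0 e" E1 g1 z P Q] ode_op_cong[of "ball 0 e" E2 g2 z P Q] E1(2) E2(2) g that by auto
  then have ode: "ode_op P Q E1 z = 0" "ode_op P Q E2 z = 0" for z
    using solution_on_UNIV[OF E1(1) open_ball ne] solution_on_UNIV[OF E2(1) open_ball ne] by blast+
  have W: "E1 z * deriv E2 z - deriv E1 z * E2 z = poly P z" for z
  proof (rule analytic_continuation_open[of "ball 0 e" UNIV "\<lambda>z. E1 z * deriv E2 z - deriv E1 z * E2 z" "poly P"])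
    fix z :: complex assume z: "z \<in> ball 0 e"
    have "\<forall>\<^sub>F w in nhds z. w \<in> ball 0 e" using z by (intro eventually_nhds_in_open) auto
    then have "\<forall>\<^sub>F w in nhds z. E1 w = g1 w" "\<forall>\<^sub>F w in nhds z. E2 w = g2 w"
      using E1(2) E2(2) by (auto elim!: eventually_mono)
    then have "deriv E1 z = deriv g1 z" "deriv E2 z = deriv g2 z"
      by (auto intro!: deriv_cong_ev)
    then show "E1 z * deriv E2 z - deriv E1 z * E2 z = poly P z"
      using g(5)[OF z] E1(2)[OF z] E2(2)[OF z] by simp
  qed (use e E1 E2 in \<open>auto intro!: holomorphic_intros\<close>)
  obtain c d where cd: "\<And>z. h z = c * E1 z + d * E2 z"
    using solution_in_span[OF h(1) E1(1) E2(1) open_UNIV connected_UNIV \<open>P \<noteq> 0\<close> h(2) ode W]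
    by (metis UNIV_I)
  \<comment> \<open>The coefficient pair of \<open>h\<close> is completed to a matrix of determinant
    1, which preserves the Wronskian \<open>P\<close>; the pair is nonzero because
    \<open>h z0 \<noteq> 0\<close>.\<close>
  obtain c' d' where c'd': "c * d' - d * c' = 1"
  proof (cases "c = 0")
    case True
    then have "d \<noteq> 0" using cd[of z0] h(3) by auto
    then show thesis using that[of 0 "- 1 / d"] that[of "- 1 / d" 0] True by simp
  next
    case False
    then show thesis using that[of "1 / c" 0] by simp
  qed
  define k where "k z = c' * E1 z + d' * E2 z" for z
  have khol: "k holomorphic_on UNIV"
    unfolding k_def using E1 E2 by (intro holomorphic_intros)
  have "h = (\<lambda>z. c * E1 z + d * E2 z)" "k = (\<lambda>z. c' * E1 z + d' * E2 z)"
    using cd by (auto simp: k_def)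
  then have dd: "deriv h z = c * deriv E1 z + d * deriv E2 z" "deriv k z = c' * deriv E1 z + d' * deriv E2 z" for z
    using deriv_lincomb[OF E1(1) E2(1) open_UNIV UNIV_I] by auto
  have Whk: "h z * deriv k z - deriv h z * k z = poly P z" for z
  proof -
    have "h z * deriv k z - deriv h z * k z = (c * d' - d * c') * (E1 z * deriv E2 z - deriv E1 z * E2 z)"
      unfolding dd cd k_def by (simp add: algebra_simps)
    then show ?thesis using W c'd' by simp
  qed
  show ?thesis
    unfolding has_meromorphic_primitive_def
  proof (intro exI[of _ "\<lambda>z. k z / h z"] conjI allI impI)
    show "(\<lambda>z. k z / h z) meromorphic_on UNIV"
      using khol h(1) by (intro meromorphic_intros analytic_on_imp_meromorphic_on)
        (simp_all add: analytic_on_open)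
    fix z assume "h z \<noteq> 0"
    then have "((\<lambda>z. k z / h z) has_field_derivative (deriv k z * h z - k z * deriv h z) / (h z * h z)) (at z)"
      using holomorphic_derivI[OF khol open_UNIV] holomorphic_derivI[OF h(1) open_UNIV]
      by (intro derivative_eq_intros refl) auto
    then show "((\<lambda>z. k z / h z) has_field_derivative poly P z / (h z)\<^sup>2) (at z)"
      using Whk[of z] by (simp add: power2_eq_square mult.commute)
  qed
qed

section \<open>The Frobenius recurrence and the Laine determinant\<close>

text \<open>Row \<open>r\<close>, counted from 0, is the recurrence for the index
  \<open>j = Suc r\<close>. The vector lists \<open>c 1, ..., c n\<close> and then
  \<open>c 0\<close>, because the last column of the matrix holds the \<open>b j\<close>.\<close>

lemma laine_matrix_mult_vec:
  assumes "r \<le> n"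
  shows "(laine_matrix (Suc n) b *\<^sub>v vec (Suc n) (\<lambda>k. if k = n then c 0 else c (Suc k))) $ r =
    (of_nat (Suc r) ^ 2 - of_nat (Suc r) * of_nat (Suc n)) * c (Suc r)
      + (\<Sum>i<Suc r. b (Suc r - i) * c i)"
proof -
  let ?d = "of_nat (Suc r) ^ 2 - of_nat (Suc r) * of_nat (Suc n) :: complex"
  let ?h = "\<lambda>k. if k < r then b (r - k) * c (Suc k) else if k = r then ?d * c (Suc k) else 0"
  have "(laine_matrix (Suc n) b *\<^sub>v vec (Suc n) (\<lambda>k. if k = n then c 0 else c (Suc k))) $ r
      = (\<Sum>k<Suc n. laine_matrix (Suc n) b $$ (r, k) * (if k = n then c 0 else c (Suc k)))"
    using assms by (simp add: laine_matrix_def scalar_prod_def atLeast0LessThan del: sum.lessThan_Suc)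
  also have "\<dots> = (\<Sum>k<n. ?h k) + b (Suc r) * c 0"
    using assms by (auto simp: laine_matrix_def Let_def intro!: sum.cong)
  also have "(\<Sum>k<n. ?h k) = (\<Sum>k<r. b (r - k) * c (Suc k)) + ?d * c (Suc r)"
  proof (cases "r = n")
    \<comment> \<open>In the last row \<open>?d = 0\<close>, which makes up for
      \<open>c (Suc n)\<close> being absent from the vector.\<close>
    case True
    then show ?thesis by (simp add: power2_eq_square)
  next
    case False
    have "(\<Sum>k<n. ?h k) = (\<Sum>k<Suc r. ?h k)"
      using assms False by (intro sum.mono_neutral_right) auto
    then show ?thesis by simp
  qed
  finally show ?thesis
    by (simp add: sum.lessThan_Suc_shift del: sum.lessThan_Suc)
qed

text \<open>A vanishing determinant means a nonzero kernel vector, whose entries solve the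
  recurrence. With \<open>m = Suc n\<close>, the indicial factor \<open>j (j - m)\<close> is nonzero
  for \<open>0 < j < m\<close>, so \<open>c 0 = 0\<close> would force the vector to vanish; hence
  \<open>c 0\<close> can be normalised to 1.\<close>

lemma laine_det_eq_0_iff:
  "laine_det (Suc n) b = 0 \<longleftrightarrow>
    (\<exists>c. c 0 = 1 \<and> (\<forall>j\<in>{1..Suc n}.
      (of_nat j ^ 2 - of_nat j * of_nat (Suc n)) * c j + (\<Sum>i<j. b (j - i) * c i) = 0))"
  (is "_ \<longleftrightarrow> (\<exists>c. c 0 = 1 \<and> (\<forall>j\<in>_. ?E c j = 0))")
proof
  let ?A = "laine_matrix (Suc n) b" and ?v = "\<lambda>c. vec (Suc n) (\<lambda>k. if k = n then c 0 else c (Suc k))"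
  have A: "?A \<in> carrier_mat (Suc n) (Suc n)"
    by (simp add: laine_matrix_def)
  note det = det_0_iff_vec_prod_zero_field[OF A, folded laine_det_def]
  {
    assume "laine_det (Suc n) b = 0"
    then obtain v where v: "v \<in> carrier_vec (Suc n)" "v \<noteq> 0\<^sub>v (Suc n)" "?A *\<^sub>v v = 0\<^sub>v (Suc n)"
      using det by blast
    \<comment> \<open>For \<open>i = Suc n\<close> this reads the same entry as for
      \<open>i = 0\<close>; in the last row that value is multiplied by the factor 0.\<close>
    define c where "c i = v $ (if i = 0 then n else i - 1)" for i
    have vc: "v = ?v c"
      using v(1) by (intro eq_vecI) (auto simp: c_def)
    have E: "?E c j = 0" if "j \<in> {1..Suc n}" for j
    proof -
      obtain r where r: "j = Suc r" "r \<le> n" using \<open>j \<in> _\<close> by (cases j) auto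
      have "(?A *\<^sub>v ?v c) $ r = 0"
        using v(3) vc r by simp
      then show ?thesis
        using laine_matrix_mult_vec[OF r(2)] r(1) by metis
    qed
    have "c 0 \<noteq> 0"
    proof
      assume c0: "c 0 = 0"
      have "c j = 0" if "j \<le> n" for j
        using that
      proof (induction j rule: less_induct)
        case (less j)
        show ?case
        proof (cases "j = 0")
          case False
          have "(\<Sum>i<j. b (j - i) * c i) = 0"
            using less by (intro sum.neutral) auto
          then have "(of_nat j ^ 2 - of_nat j * of_nat (Suc n) :: complex) * c j = 0"
            using E[of j] less.prems False by auto
          moreover have "(of_nat j ^ 2 - of_nat j * of_nat (Suc n) :: complex) = of_nat j * (of_nat j - of_nat (Suc n))"
            by (simp add: power2_eq_square algebra_simps)
          moreover have "of_nat j \<noteq> (of_nat (Suc n) :: complex)"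
            using less.prems of_nat_eq_iff[of j "Suc n", where 'a = complex] by linarith
          ultimately show ?thesis
            using False by auto
        qed (use c0 in simp)
      qed
      then have "v = 0\<^sub>v (Suc n)"
        unfolding vc by (intro eq_vecI) auto
      then show False using v(2) by simp
    qed
    then have "(\<lambda>i. c i / c 0) 0 = 1" by simp
    moreover have "\<forall>j\<in>{1..Suc n}. ?E (\<lambda>i. c i / c 0) j = 0"
    proof
      fix j assume "j \<in> {1..Suc n}"
      have "?E (\<lambda>i. c i / c 0) j = ?E c j / c 0"
        by (simp add: add_divide_distrib sum_divide_distrib)
      then show "?E (\<lambda>i. c i / c 0) j = 0" using E \<open>j \<in> _\<close> by simp
    qed
    ultimately show "\<exists>c. c 0 = 1 \<and> (\<forall>j\<in>{1..Suc n}. ?E c j = 0)"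
      by (intro exI[of _ "\<lambda>i. c i / c 0"] conjI)
  next
    assume "\<exists>c. c 0 = 1 \<and> (\<forall>j\<in>{1..Suc n}. ?E c j = 0)"
    then obtain c where c: "c 0 = 1" "\<And>j. j \<in> {1..Suc n} \<Longrightarrow> ?E c j = 0" by blast
    have "?A *\<^sub>v ?v c = 0\<^sub>v (Suc n)"
    proof (rule eq_vecI)
      fix r assume "r < dim_vec (0\<^sub>v (Suc n))"
      then have r: "r \<le> n" by simp
      have "(?A *\<^sub>v ?v c) $ r = ?E c (Suc r)"
        by (rule laine_matrix_mult_vec[OF r])
      also have "\<dots> = 0" using c(2)[of "Suc r"] r by simp
      finally show "(?A *\<^sub>v ?v c) $ r = 0\<^sub>v (Suc n) $ r" using r by simp
    qed (simp add: laine_matrix_def)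
    moreover have "?v c $ n = 1" using c(1) by simp
    then have "?v c \<noteq> 0\<^sub>v (Suc n)"
      by (metis index_zero_vec(1) lessI zero_neq_one)
    ultimately show "laine_det (Suc n) b = 0"
      by (intro iffD2[OF det] exI[of _ "?v c"] conjI vec_carrier)
  }
qed

text \<open>Beyond the index \<open>m\<close> the indicial factor \<open>j^2 - j m\<close> is nonzero, so the recurrence can be solved
  for \<open>c j\<close>.\<close>

function frobenius_coeff ::
  "nat \<Rightarrow> (nat \<Rightarrow> complex) \<Rightarrow> (nat \<Rightarrow> complex) \<Rightarrow> nat \<Rightarrow> complex" where
  "frobenius_coeff m b c j =
     (if j \<le> m then c j
      else - (\<Sum>i<j. b (j - i) * frobenius_coeff m b c i) / (of_nat j ^ 2 - of_nat j * of_nat m))"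
  by auto
termination by (relation "Wellfounded.measure (\<lambda>(m, b, c, j). j)") auto

declare frobenius_coeff.simps [simp del]

lemma frobenius_coeff_initial: "j \<le> m \<Longrightarrow> frobenius_coeff m b c j = c j"
  by (simp add: frobenius_coeff.simps)

text \<open>The factor is the positive integer \<open>j (j - m)\<close>. The bound permits division
  by it and lets it be dropped in the growth estimate.\<close>

lemma frobenius_indicial_bound:
  assumes "j > m"
  shows "norm (of_nat j ^ 2 - of_nat j * of_nat m :: complex) \<ge> 1"
proof -
  have "(of_nat j ^ 2 - of_nat j * of_nat m :: complex) = of_nat (j * (j - m))"
    using assms by (simp add: power2_eq_square algebra_simps of_nat_diff)
  moreover have "j * (j - m) \<ge> 1" using assms by simp
  ultimately show ?thesis by (metis norm_of_nat of_nat_1 of_nat_mono)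
qed

lemma laine_recurrence_extends:
  fixes b c :: "nat \<Rightarrow> complex"
  assumes "\<forall>j\<in>{1..m}. (of_nat j ^ 2 - of_nat j * of_nat m) * c j + (\<Sum>i<j. b (j - i) * c i) = 0"
  obtains c' where "c' 0 = c 0"
    and "\<And>j. j \<ge> 1 \<Longrightarrow> (of_nat j ^ 2 - of_nat j * of_nat m) * c' j + (\<Sum>i<j. b (j - i) * c' i) = 0"
proof
  let ?f = "frobenius_coeff m b c"
  show "?f 0 = c 0" by (simp add: frobenius_coeff_initial)
  fix j :: nat assume j: "j \<ge> 1"
  show "(of_nat j ^ 2 - of_nat j * of_nat m) * ?f j + (\<Sum>i<j. b (j - i) * ?f i) = 0"
  proof (cases "j \<le> m")
    case True
    have "(\<Sum>i<j. b (j - i) * ?f i) = (\<Sum>i<j. b (j - i) * c i)"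
      using True by (intro sum.cong) (auto simp: frobenius_coeff_initial)
    then show ?thesis
      using assms True j by (simp add: frobenius_coeff_initial)
  next
    case False
    have "of_nat j ^ 2 - of_nat j * of_nat m \<noteq> (0 :: complex)"
      using frobenius_indicial_bound[of m j] False by auto
    then show ?thesis
      using False by (subst frobenius_coeff.simps) simp
  qed
qed

section \<open>Convergence of the formal solution\<close>

lemma laine_recurrence_growth:
  fixes c :: "nat \<Rightarrow> complex"
  assumes rec: "\<And>j. j \<ge> 1 \<Longrightarrow> (of_nat j ^ 2 - of_nat j * of_nat m) * c j + (\<Sum>i<j. b (j - i) * c i) = 0"
    and b: "\<And>k. k \<ge> 1 \<Longrightarrow> norm (b k) \<le> M * K ^ k" and "K > 0" "M \<ge> 0"
  obtains A L where "L > 0" "\<And>j. norm (c j) \<le> A * L ^ j"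
proof -
  \<comment> \<open>With this choice \<open>K L^j + K M L^j = L^(j + 1)\<close>, which closes the
    induction for \<open>geo\<close>.\<close>
  define L where "L = K * (1 + M)"
  have L: "L > 0" "K \<le> L" using assms by (auto simp: L_def)
  \<comment> \<open>Covers the indices up to \<open>m\<close>, which the indicial bound does not
    reach.\<close>
  define A where "A = (\<Sum>j\<le>m. norm (c j) / L ^ j)"
  have A0: "A \<ge> 0" using L by (auto simp: A_def intro!: sum_nonneg)
  have "norm (c j) \<le> A * L ^ j" for j
  proof (induction j rule: less_induct)
    case (less j)
    show ?case
    proof (cases "j \<le> m")
      case True
      have "norm (c j) / L ^ j \<le> A"
        unfolding A_def using True L by (intro member_le_sum) auto
      then show ?thesis using L by (simp add: field_simps)
    next
      case False
      have geo: "M * (\<Sum>i<j. K ^ (j - i) * L ^ i) \<le> L ^ j" for j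
      proof (induction j)
        case (Suc j)
        have "(\<Sum>i<Suc j. K ^ (Suc j - i) * L ^ i) = K * (\<Sum>i<j. K ^ (j - i) * L ^ i) + K * L ^ j"
          by (simp add: sum_distrib_left Suc_diff_le mult.assoc)
        then have "M * (\<Sum>i<Suc j. K ^ (Suc j - i) * L ^ i)
            = K * (M * (\<Sum>i<j. K ^ (j - i) * L ^ i)) + K * M * L ^ j"
          by (simp add: algebra_simps)
        also have "\<dots> \<le> K * L ^ j + K * M * L ^ j"
          using Suc \<open>K > 0\<close> by simp
        finally show ?case by (simp add: L_def algebra_simps)
      qed simp
      have "norm (c j) \<le> norm (of_nat j ^ 2 - of_nat j * of_nat m :: complex) * norm (c j)"
        using frobenius_indicial_bound[of m j] False mult_right_mono[of 1 _ "norm (c j)"] by simp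
      also have "\<dots> = norm (\<Sum>i<j. b (j - i) * c i)"
      proof -
        have "(of_nat j ^ 2 - of_nat j * of_nat m) * c j = - (\<Sum>i<j. b (j - i) * c i)"
          using rec[of j] False by (simp add: eq_neg_iff_add_eq_0)
        then show ?thesis by (metis norm_minus_cancel norm_mult)
      qed
      also have "\<dots> \<le> (\<Sum>i<j. (M * K ^ (j - i)) * (A * L ^ i))"
        using b less \<open>K > 0\<close> \<open>M \<ge> 0\<close> by (intro sum_norm_le) (auto simp: norm_mult intro!: mult_mono)
      also have "\<dots> = A * (M * (\<Sum>i<j. K ^ (j - i) * L ^ i))"
        by (simp add: sum_distrib_left mult_ac)
      also have "\<dots> \<le> A * L ^ j"
        using geo A0 by (intro mult_left_mono)
      finally show ?thesis .
    qed
  qed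
  then show thesis using that L by blast
qed

lemma fps_conv_radius_pos_of_growth:
  fixes F :: "complex fps"
  assumes "L > 0" "\<And>j. norm (fps_nth F j) \<le> A * L ^ j"
  shows "fps_conv_radius F > 0"
proof -
  let ?r = "1 / (2 * L)"
  have "summable (\<lambda>j. A * (1/2) ^ j :: real)"
    by (intro summable_mult summable_geometric) simp
  moreover have "norm (fps_nth F j * of_real ?r ^ j) \<le> A * (1/2) ^ j" for j
  proof -
    have "norm (fps_nth F j * of_real ?r ^ j) \<le> (A * L ^ j) * ?r ^ j"
      using assms mult_right_mono[OF assms(2), of "?r ^ j" j] by (simp add: norm_mult norm_power norm_divide)
    also have "\<dots> = A * (1/2) ^ j"
      using assms(1) by (simp add: power_divide power_mult_distrib)
    finally show ?thesis .
  qed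
  ultimately have "summable (\<lambda>j. fps_nth F j * of_real ?r ^ j)"
    by (rule summable_comparison_test'[rule_format, where N = 0])
  then have "fps_conv_radius F \<ge> norm (complex_of_real ?r)"
    unfolding fps_conv_radius_def by (rule conv_radius_geI)
  moreover have "ereal (norm (complex_of_real ?r)) > 0" using assms(1) by simp
  ultimately show ?thesis by (meson order_less_le_trans)
qed

lemma fps_nth_growth:
  fixes F :: "complex fps"
  assumes "fps_conv_radius F > 0"
  obtains M K where "K > 0" "M \<ge> 0" "\<And>j. norm (fps_nth F j) \<le> M * K ^ j"
proof -
  obtain r where r: "0 < ereal r" "ereal r < fps_conv_radius F"
    using ereal_dense2[OF assms] by blast
  then have "summable (\<lambda>j. fps_nth F j * of_real r ^ j)"
    unfolding fps_conv_radius_def by (intro summable_in_conv_radius) auto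
  then have "bounded (range (\<lambda>j. fps_nth F j * of_real r ^ j))"
    using summable_imp_bounded by blast
  then obtain M where M: "M > 0" "\<And>j. norm (fps_nth F j * of_real r ^ j) \<le> M"
    by (auto simp: bounded_pos)
  show thesis
  proof
    show "1 / r > 0" "M \<ge> 0" using r M by auto
    show "norm (fps_nth F j) \<le> M * (1 / r) ^ j" for j
      using M(2)[of j] r by (simp add: norm_mult norm_power power_divide field_simps)
  qed
qed

text \<open>The coefficient of degree \<open>k\<close> is the recurrence for
  \<open>j = k + 1\<close>. This shift by one is why \<open>b k\<close> in the recurrence is the
  coefficient \<open>k - 1\<close> of \<open>F\<close>.\<close>

lemma fps_frobenius_iff:
  fixes U F :: "complex fps"
  shows "fps_X * fps_deriv (fps_deriv U) - fps_const (of_nat n) * fps_deriv U + F * U = 0 \<longleftrightarrow>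
    (\<forall>j\<ge>1. (of_nat j ^ 2 - of_nat j * of_nat (Suc n)) * fps_nth U j
        + (\<Sum>i<j. fps_nth F (j - i - 1) * fps_nth U i) = 0)"
proof -
  have "fps_nth (fps_X * fps_deriv (fps_deriv U) - fps_const (of_nat n) * fps_deriv U + F * U) k =
     (of_nat (Suc k) ^ 2 - of_nat (Suc k) * of_nat (Suc n)) * fps_nth U (Suc k)
        + (\<Sum>i<Suc k. fps_nth F (Suc k - i - 1) * fps_nth U i)" for k
  proof -
    have "fps_nth (F * U) k = (\<Sum>i<Suc k. fps_nth F (Suc k - i - 1) * fps_nth U i)"
      by (subst mult.commute[of F])
        (simp add: fps_mult_nth atLeast0AtMost lessThan_Suc_atMost mult.commute[of "fps_nth F _"])
    moreover have "fps_nth (fps_X * fps_deriv (fps_deriv U)) k = of_nat k * of_nat (Suc k) * fps_nth U (Suc k)"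
      by (cases k) (simp_all add: algebra_simps)
    ultimately show ?thesis
      by (simp add: power2_eq_square algebra_simps)
  qed
  note * = this
  show ?thesis
    unfolding fps_eq_iff * fps_zero_nth
    by (auto simp del: sum.lessThan_Suc dest!: Suc_le_D)
qed

lemma deriv_shift_fun: "deriv (\<lambda>w. f (p + w)) = (\<lambda>w. deriv f (p + w))"
  by (rule ext) (simp add: deriv_def DERIV_shift add.commute[of p])

text \<open>Taylor coefficients divided by \<open>u p\<close> turn an analytic solution into a
  normalised solution of the recurrence. Conversely, a solution up to the index
  \<open>m = n + 1\<close> is continued beyond it, and the growth bound makes the formal series
  converge.\<close>

lemma frobenius_germ_iff:
  fixes C :: "complex \<Rightarrow> complex"
  assumes C: "C analytic_on {p}"
  shows "(\<exists>u. u analytic_on {p} \<and> u p \<noteq> 0 \<and>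
      (\<forall>\<^sub>F z in nhds p. (z - p) * deriv (deriv u) z - of_nat n * deriv u z + C z * u z = 0)) \<longleftrightarrow>
    laine_det (Suc n) (\<lambda>k. fps_nth (fps_expansion C p) (k - 1)) = 0"
    (is "?lhs \<longleftrightarrow> laine_det _ ?b = 0")
proof -
  define F where "F = fps_expansion C p"
  have F: "(\<lambda>w. C (p + w)) has_fps_expansion F"
    unfolding F_def by (rule analytic_at_imp_has_fps_expansion[OF C])
  have op: "(\<lambda>w. w * deriv (deriv u) (p + w) - of_nat n * deriv u (p + w) + C (p + w) * u (p + w))
      has_fps_expansion fps_X * fps_deriv (fps_deriv U) - fps_const (of_nat n) * fps_deriv U + F * U"
    if U: "(\<lambda>w. u (p + w)) has_fps_expansion U" for u U
  proof -
    have 1: "(\<lambda>w. deriv u (p + w)) has_fps_expansion fps_deriv U"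
      using has_fps_expansion_deriv[OF U] by (simp add: deriv_shift_fun)
    have 2: "(\<lambda>w. deriv (deriv u) (p + w)) has_fps_expansion fps_deriv (fps_deriv U)"
      using has_fps_expansion_deriv[OF 1] by (simp add: deriv_shift_fun)
    show ?thesis by (intro fps_expansion_intros U 1 2 F)
  qed
  have nh: "filtermap (\<lambda>w. w - (- p)) (nhds 0) = nhds p"
    by (subst filtermap_nhds_shift) simp
  have ev: "(\<forall>\<^sub>F z in nhds p. (z - p) * deriv (deriv u) z - of_nat n * deriv u z + C z * u z = 0) \<longleftrightarrow>
      fps_X * fps_deriv (fps_deriv U) - fps_const (of_nat n) * fps_deriv U + F * U = 0"
    if U: "(\<lambda>w. u (p + w)) has_fps_expansion U" for u U
  proof -
    have "(\<forall>\<^sub>F z in nhds p. (z - p) * deriv (deriv u) z - of_nat n * deriv u z + C z * u z = 0) \<longleftrightarrow>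
      (\<forall>\<^sub>F w in nhds 0. w * deriv (deriv u) (p + w) - of_nat n * deriv u (p + w) + C (p + w) * u (p + w) = 0)"
      unfolding nh[symmetric] eventually_filtermap by (simp add: add.commute)
    also have "\<dots> \<longleftrightarrow> (\<lambda>w. w * deriv (deriv u) (p + w) - of_nat n * deriv u (p + w) + C (p + w) * u (p + w)) has_fps_expansion 0"
      by (rule has_fps_expansion_0_iff[symmetric])
    also have "\<dots> \<longleftrightarrow> fps_X * fps_deriv (fps_deriv U) - fps_const (of_nat n) * fps_deriv U + F * U = 0"
      (is "?f has_fps_expansion 0 \<longleftrightarrow> ?G = 0")
    proof
      assume "?f has_fps_expansion 0"
      then show "?G = 0" by (rule fps_expansion_unique_complex[OF op[OF U]])
    next
      assume "?G = 0"
      then show "?f has_fps_expansion 0" using op[OF U] by (rule subst)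
    qed
    finally show ?thesis .
  qed
  show ?thesis
  proof
    assume ?lhs
    then obtain u where u: "u analytic_on {p}" "u p \<noteq> 0"
      "\<forall>\<^sub>F z in nhds p. (z - p) * deriv (deriv u) z - of_nat n * deriv u z + C z * u z = 0" by blast
    define U where "U = fps_expansion u p"
    have U: "(\<lambda>w. u (p + w)) has_fps_expansion U"
      unfolding U_def by (rule analytic_at_imp_has_fps_expansion[OF u(1)])
    have U0: "fps_nth U 0 = u p"
      using has_fps_expansion_imp_0_eq_fps_nth_0[OF U] by simp
    have rec: "(of_nat j ^ 2 - of_nat j * of_nat (Suc n)) * fps_nth U j
        + (\<Sum>i<j. fps_nth F (j - i - 1) * fps_nth U i) = 0" if "j \<ge> 1" for j
      using ev[OF U] u(3) fps_frobenius_iff that by blast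
    have "(of_nat j ^ 2 - of_nat j * of_nat (Suc n)) * (fps_nth U j / u p)
        + (\<Sum>i<j. fps_nth F (j - i - 1) * (fps_nth U i / u p)) = 0" if "j \<ge> 1" for j
    proof -
      have "(of_nat j ^ 2 - of_nat j * of_nat (Suc n)) * (fps_nth U j / u p)
        + (\<Sum>i<j. fps_nth F (j - i - 1) * (fps_nth U i / u p)) =
        ((of_nat j ^ 2 - of_nat j * of_nat (Suc n)) * fps_nth U j
        + (\<Sum>i<j. fps_nth F (j - i - 1) * fps_nth U i)) / u p"
        by (simp add: add_divide_distrib sum_divide_distrib)
      then show ?thesis using rec[OF that] by simp
    qed
    then show "laine_det (Suc n) ?b = 0"
      unfolding laine_det_eq_0_iff using u(2) U0
      by (intro exI[of _ "\<lambda>j. fps_nth U j / u p"]) (auto simp: F_def)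
  next
    assume "laine_det (Suc n) ?b = 0"
    then obtain c0 where c0: "c0 0 = 1" "\<forall>j\<in>{1..Suc n}.
      (of_nat j ^ 2 - of_nat j * of_nat (Suc n)) * c0 j + (\<Sum>i<j. ?b (j - i) * c0 i) = 0"
      unfolding laine_det_eq_0_iff by blast
    obtain c where c: "c 0 = c0 0" "\<And>j. j \<ge> 1 \<Longrightarrow>
      (of_nat j ^ 2 - of_nat j * of_nat (Suc n)) * c j + (\<Sum>i<j. ?b (j - i) * c i) = 0"
      using laine_recurrence_extends[OF c0(2)] by blast
    obtain M K where MK: "K > 0" "M \<ge> 0" "\<And>j. norm (fps_nth F j) \<le> M * K ^ j"
      using fps_nth_growth F by (metis has_fps_expansion_def)
    \<comment> \<open>The division by \<open>K\<close> accounts for the index shift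
      \<open>k - 1\<close>.\<close>
    have bnd: "norm (?b k) \<le> (M / K) * K ^ k" if "k \<ge> 1" for k
      using MK(3)[of "k - 1"] MK(1) that by (cases k) (auto simp: F_def)
    obtain A L where AL: "L > 0" "\<And>j. norm (c j) \<le> A * L ^ j"
      by (rule laine_recurrence_growth[OF c(2) bnd MK(1)]) (use MK in auto)
    define U where "U = Abs_fps c"
    have rad: "fps_conv_radius U > 0"
      using AL by (intro fps_conv_radius_pos_of_growth[of L _ A]) (auto simp: U_def)
    define u where "u z = eval_fps U (z - p)" for z
    have U: "(\<lambda>w. u (p + w)) has_fps_expansion U"
      using eval_fps_has_fps_expansion[OF rad] by (simp add: u_def)
    have "fps_X * fps_deriv (fps_deriv U) - fps_const (of_nat n) * fps_deriv U + F * U = 0"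
      unfolding fps_frobenius_iff using c(2) by (auto simp: U_def F_def)
    moreover have "u analytic_on {p}"
      using has_fps_expansion_imp_analytic[OF U] .
    moreover have "u p \<noteq> 0"
      using c0 c by (simp add: u_def eval_fps_at_0 U_def)
    ultimately show ?lhs using ev[OF U] by blast
  qed
qed

section \<open>Expansion at a zero of the leading coefficient\<close>

lemma analytic_on_poly: "poly (q :: complex poly) analytic_on S"
  by (rule analytic_on_subset[of _ UNIV]) (simp_all add: analytic_on_open poly_holomorphic_on)

lemma filterlim_power_diff_at_0:
  assumes "j > 0"
  shows "filterlim (\<lambda>z. (z - p) ^ j) (at (0 :: complex)) (at p)"
proof (rule filterlim_atI)
  show "((\<lambda>z. (z - p) ^ j) \<longlongrightarrow> 0) (at p)"
    using assms by (auto intro!: tendsto_eq_intros)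
  show "\<forall>\<^sub>F z in at p. (z - p) ^ j \<noteq> 0"
    unfolding eventually_at_filter by (rule always_eventually) auto
qed

lemma pderiv_linear: "pderiv [:a, 1:] = (1 :: complex poly)"
  by (simp add: pderiv_pCons)

text \<open>Multiplication by \<open>X\<close> avoids the exponent \<open>n - 1\<close>, so that
  \<open>n = 0\<close> is covered by the same formula.\<close>

lemma mult_pderiv_power_mult:
  fixes X A :: "complex poly"
  assumes "pderiv X = 1"
  shows "X * pderiv (X ^ n * A) = X ^ n * (of_nat n * A + X * pderiv A)"
proof (cases n)
  case (Suc k)
  have "Polynomial.smult (of_nat (Suc k)) q = of_nat (Suc k) * q" for q :: "complex poly"
    unfolding of_nat_poly by simp
  then have "pderiv (X ^ Suc k) = of_nat (Suc k) * X ^ k"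
    unfolding pderiv_power_Suc assms by simp
  then show ?thesis
    unfolding Suc pderiv_mult by (simp add: algebra_simps)
qed simp

text \<open>Identities obtained by cancelling powers of \<open>z - p\<close> hold only off
  \<open>p\<close>; this supplies the centre.\<close>

lemma holomorphic_zero_at_centre:
  assumes "f holomorphic_on ball p e" "e > 0" "\<And>z. z \<in> ball p e \<Longrightarrow> z \<noteq> p \<Longrightarrow> f z = 0" "z \<in> ball p e"
  shows "f z = 0"
proof (rule analytic_continuation_open[of "ball p e - {p}" "ball p e" f "\<lambda>_. 0"])
  have "p + of_real (e / 2) \<in> ball p e - {p}"
    using assms(2) by (simp add: dist_norm)
  then show "ball p e - {p} \<noteq> {}" by blast
qed (use assms in auto)

text \<open>The second factorisation says without division that \<open>Q / P\<close> has at most a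
  simple pole at \<open>p\<close>: near but off \<open>p\<close>,
  \<open>(z - p) Q / P = Q1 / P1\<close>. The case \<open>n = 0\<close> is an ordinary
  point.\<close>

locale factored_ode =
  fixes P Q :: "complex poly" and p :: complex and n :: nat and P1 Q1 :: "complex poly"
  assumes P_factor: "P = [:-p, 1:] ^ n * P1" and P1_nz: "poly P1 p \<noteq> 0"
    and Q_factor: "[:-p, 1:] * Q = [:-p, 1:] ^ n * Q1"
begin

text \<open>Chosen such that \<open>g = u * sqrt P1\<close> solves the equation iff
  \<open>(z - p) u'' - n u' + C u = 0\<close>, and \<open>R - (1 - (n + 1)^2) / (4 (z - p)^2) = C / (z - p)\<close>.\<close>

definition C :: "complex \<Rightarrow> complex" where
  "C z = - (of_nat n / 2) * (poly (pderiv P1) z / poly P1 z)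
      + (z - p) * (poly (pderiv (pderiv P1)) z / (2 * poly P1 z)
                   - 3 / 4 * (poly (pderiv P1) z / poly P1 z) ^ 2)
      + poly Q1 z / poly P1 z"

lemma poly_P: "poly P z = (z - p) ^ n * poly P1 z"
  by (simp add: P_factor)

lemma poly_Q: "(z - p) * poly Q z = (z - p) ^ n * poly Q1 z"
  using arg_cong[OF Q_factor, of "\<lambda>q. poly q z"] by (simp add: algebra_simps)

lemma poly_pderiv_P:
  "(z - p) * poly (pderiv P) z =
     (z - p) ^ n * (of_nat n * poly P1 z + (z - p) * poly (pderiv P1) z)"
  using arg_cong[OF mult_pderiv_power_mult[OF pderiv_linear, of "- p" n P1], of "\<lambda>q. poly q z"]
  unfolding P_factor[symmetric] by (simp add: algebra_simps)

text \<open>The operator \<open>X d/dX\<close> is applied twice: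
  \<open>X (X P')' = X P' + X^2 P''\<close>, from which the first-order formula is
  subtracted.\<close>

lemma poly_pderiv2_P:
  "(z - p) ^ 2 * poly (pderiv (pderiv P)) z =
     (z - p) ^ n * (of_nat n * (of_nat n - 1) * poly P1 z
       + 2 * of_nat n * (z - p) * poly (pderiv P1) z + (z - p) ^ 2 * poly (pderiv (pderiv P1)) z)"
proof -
  define X where "X = [:-p, 1:]"
  have X: "pderiv X = 1" "poly X z = z - p"
    by (simp_all add: X_def pderiv_linear)
  let ?T = "of_nat n * P1 + X * pderiv P1"
  have "X * pderiv P = X ^ n * ?T"
    using mult_pderiv_power_mult[OF X(1)] P_factor X_def by simp
  then have "X * pderiv (X * pderiv P) = X ^ n * (of_nat n * ?T + X * pderiv ?T)"
    using mult_pderiv_power_mult[OF X(1)] by simp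
  moreover have "pderiv (X * pderiv P) = pderiv P + X * pderiv (pderiv P)"
    by (simp add: pderiv_mult X)
  moreover have "pderiv ?T = of_nat n * pderiv P1 + pderiv P1 + X * pderiv (pderiv P1)"
    by (simp add: pderiv_mult pderiv_add X pderiv_of_nat)
  ultimately have "X * (pderiv P + X * pderiv (pderiv P))
      = X ^ n * (of_nat n * ?T + X * (of_nat n * pderiv P1 + pderiv P1 + X * pderiv (pderiv P1)))"
    by simp
  then have "poly (X * (pderiv P + X * pderiv (pderiv P))) z
      = poly (X ^ n * (of_nat n * ?T + X * (of_nat n * pderiv P1 + pderiv P1 + X * pderiv (pderiv P1)))) z"
    by simp
  then have "(z - p) * poly (pderiv P) z + (z - p) * ((z - p) * poly (pderiv (pderiv P)) z) =
    (z - p) ^ n * (of_nat n * (of_nat n * poly P1 z + (z - p) * poly (pderiv P1) z)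
      + (z - p) * (of_nat n * poly (pderiv P1) z + poly (pderiv P1) z + (z - p) * poly (pderiv (pderiv P1)) z))"
    unfolding poly_mult poly_add poly_power poly_of_nat X distrib_left by simp
  then show ?thesis
    unfolding poly_pderiv_P by (simp add: power2_eq_square algebra_simps)
qed

text \<open>The double pole has coefficient
  \<open>n (n - 1) / 2 - 3 n^2 / 4 = (1 - (n + 1)^2) / 4\<close>; the Laine integer at a zero of
  order \<open>n\<close> is therefore \<open>m = n + 1\<close>.\<close>

lemma R_fun_eq:
  assumes "z \<noteq> p" "poly P1 z \<noteq> 0"
  shows "R_fun P Q z = (1 - of_nat (Suc n) ^ 2) / 4 / (z - p) ^ 2 + C z / (z - p)"
proof -
  define d where "d = z - p"
  have d: "d \<noteq> 0" using assms by (simp add: d_def)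
  let ?a = "poly P1 z" and ?b = "poly (pderiv P1) z" and ?c = "poly (pderiv (pderiv P1)) z"
  have 1: "poly (pderiv P) z = d ^ n * (of_nat n * ?a + d * ?b) / d"
    using poly_pderiv_P[of z] d unfolding d_def[symmetric] by (simp add: field_simps)
  have 2: "poly (pderiv (pderiv P)) z
      = d ^ n * (of_nat n * (of_nat n - 1) * ?a + 2 * of_nat n * d * ?b + d ^ 2 * ?c) / d ^ 2"
    using poly_pderiv2_P[of z] d unfolding d_def[symmetric] by (simp add: field_simps)
  have 3: "poly Q z = d ^ n * poly Q1 z / d"
    using poly_Q[of z] d unfolding d_def[symmetric] by (simp add: field_simps)
  have 4: "poly P z = d ^ n * ?a" unfolding poly_P d_def ..
  have e1: "poly (pderiv P) z / poly P z = of_nat n / d + ?b / ?a"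
    unfolding 1 4 using d assms(2) by (simp add: field_simps)
  have e2: "poly (pderiv (pderiv P)) z / poly P z
      = of_nat n * (of_nat n - 1) / d ^ 2 + 2 * of_nat n / d * (?b / ?a) + ?c / ?a"
    unfolding 2 4 using d assms(2) by (simp add: field_simps power2_eq_square)
  have e3: "poly Q z / poly P z = poly Q1 z / ?a / d"
    unfolding 3 4 using d assms(2) by (simp add: field_simps)
  define L where "L = ?b / ?a"
  define K where "K = ?c / ?a"
  define q where "q = poly Q1 z / ?a"
  define N :: complex where "N = of_nat n"
  have C: "C z = - (N / 2) * L + d * (K / 2 - 3 / 4 * L ^ 2) + q"
    unfolding C_def L_def K_def q_def N_def d_def by simp
  show ?thesis
    unfolding R_fun_def e1 e2 e3 C L_def[symmetric] K_def[symmetric] q_def[symmetric] d_def[symmetric]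
    using d by (simp add: N_def[symmetric] field_simps power2_eq_square)
qed

text \<open>The factor \<open>s\<close>, a square root of \<open>P1\<close>, removes the
  \<open>P1' / P1\<close> part of the first-order term and leaves only the singular coefficient
  \<open>- n / (z - p)\<close>.\<close>

lemma ode_op_mult_sqrt:
  assumes S: "open S" "z \<in> S" "s holomorphic_on S" "u holomorphic_on S"
    and s2: "\<And>w. w \<in> S \<Longrightarrow> poly P1 w = s w ^ 2" and nz: "s z \<noteq> 0"
  shows "(z - p) * ode_op P Q (\<lambda>w. s w * u w) z =
    (z - p) ^ n * s z ^ 3 * ((z - p) * deriv (deriv u) z - of_nat n * deriv u z + C z * u z)"
proof -
  note sD = holomorphic_has_derivs[OF S(3,1)] and uD = holomorphic_has_derivs[OF S(4,1)]
  let ?s' = "deriv s z" and ?s'' = "deriv (deriv s) z" and ?u' = "deriv u z" and ?u'' = "deriv (deriv u) z"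
  have g: "deriv (\<lambda>w. s w * u w) z = deriv s z * u z + s z * deriv u z"
    "deriv (deriv (\<lambda>w. s w * u w)) z = ?s'' * u z + 2 * ?s' * ?u' + s z * ?u''"
    by (rule deriv_eqI_open[OF S(1) _ S(2), of _ "\<lambda>w. deriv s w * u w + s w * deriv u w"];
        auto intro!: derivative_eq_intros sD uD S(2))+
  have q: "deriv (\<lambda>w. s w ^ 2) z = 2 * s z * ?s'"
    "deriv (deriv (\<lambda>w. s w ^ 2)) z = 2 * ?s' ^ 2 + 2 * s z * ?s''"
    by (rule deriv_eqI_open[OF S(1) _ S(2), of _ "\<lambda>w. 2 * s w * deriv s w"];
        auto intro!: derivative_eq_intros sD S(2) simp: power2_eq_square)+
  have p: "deriv (poly P1) z = poly (pderiv P1) z" "deriv (deriv (poly P1)) z = poly (pderiv (pderiv P1)) z"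
    by (rule deriv_eqI_open[OF S(1) _ S(2), of _ "poly (pderiv P1)"]; auto intro!: poly_DERIV)+
  have ev: "\<forall>\<^sub>F w in nhds z. poly P1 w = s w ^ 2"
    using S(1,2) s2 eventually_nhds by blast
  \<comment> \<open>Differentiating \<open>P1 = s^2\<close> expresses \<open>P1'\<close> and
    \<open>P1''\<close> through \<open>s\<close>, so the remaining identity is purely
    algebraic.\<close>
  have b: "poly (pderiv P1) z = 2 * s z * ?s'"
    using deriv_cong_ev[OF ev refl] p q by simp
  have c: "poly (pderiv (pderiv P1)) z = 2 * ?s' ^ 2 + 2 * s z * ?s''"
    using higher_deriv_cong_ev[OF ev refl, of 2] p q by (simp add: numeral_2_eq_2)
  define d where "d = z - p"
  have "d * ode_op P Q (\<lambda>w. s w * u w) z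
     = (d * poly P z) * (?s'' * u z + 2 * ?s' * ?u' + s z * ?u'')
       - (d * poly (pderiv P) z) * (?s' * u z + s z * ?u') + (d * poly Q z) * (s z * u z)"
    unfolding ode_op_def g by (simp add: algebra_simps)
  also have "\<dots> = d ^ n * (d * s z ^ 2 * (?s'' * u z + 2 * ?s' * ?u' + s z * ?u'')
       - (of_nat n * s z ^ 2 + d * (2 * s z * ?s')) * (?s' * u z + s z * ?u') + poly Q1 z * (s z * u z))"
    unfolding d_def poly_pderiv_P poly_Q poly_P b s2[OF S(2)] by (simp add: algebra_simps)
  also have "\<dots> = d ^ n * (s z ^ 3 * (d * ?u'' - of_nat n * ?u')
      + (- of_nat n * ?s' * s z ^ 2 + d * s z * (s z * ?s'' - 2 * ?s' ^ 2) + poly Q1 z * s z) * u z)"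
    by (simp add: algebra_simps power2_eq_square power3_eq_cube)
  also have "- of_nat n * ?s' * s z ^ 2 + d * s z * (s z * ?s'' - 2 * ?s' ^ 2) + poly Q1 z * s z
      = s z ^ 3 * C z"
    unfolding C_def b c s2[OF S(2)] d_def[symmetric] using nz
    by (simp add: field_simps power2_eq_square power3_eq_cube)
  finally show ?thesis unfolding d_def by (simp add: algebra_simps)
qed

lemma C_analytic: "C analytic_on {p}"
  unfolding C_def using P1_nz by (intro analytic_intros analytic_on_poly) auto

text \<open>Near \<open>p\<close> the factor \<open>P1\<close> has a nonvanishing square root
  \<open>s\<close>, so nonvanishing solutions \<open>g\<close> correspond to nonvanishing
  \<open>u = g / s\<close>, to which the germ criterion with \<open>m = n + 1\<close>
  applies.\<close>

lemma unit_solution_iff: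
  "unit_solution_at P Q p \<longleftrightarrow> laine_det (Suc n) (\<lambda>k. fps_nth (fps_expansion C p) (k - 1)) = 0"
proof -
  let ?E = "\<lambda>u z. (z - p) * deriv (deriv u) z - of_nat n * deriv u z + C z * u z"
  have "\<forall>\<^sub>F z in nhds p. poly P1 z \<noteq> 0"
    using P1_nz by (intro eventually_nhds_in_open[of "{z. poly P1 z \<noteq> 0}", simplified] open_Collect_neq continuous_intros) auto
  then obtain r where r: "r > 0" "\<And>z. z \<in> ball p r \<Longrightarrow> poly P1 z \<noteq> 0"
    unfolding eventually_nhds_metric by (auto simp: dist_commute)
  obtain s where s: "s holomorphic_on ball p r" "\<And>z. z \<in> ball p r \<Longrightarrow> poly P1 z = s z ^ 2"
    by (rule contractible_imp_holomorphic_sqrt[OF poly_holomorphic_on[OF holomorphic_on_ident]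
          convex_imp_contractible[OF convex_ball] r(2)]) auto
  have snz: "s z \<noteq> 0" if "z \<in> ball p r" for z
    using r(2)[OF that] s(2)[OF that] by auto
  have Chol: "C holomorphic_on ball p r"
    unfolding C_def using r by (intro holomorphic_intros) auto
  have "unit_solution_at P Q p \<longleftrightarrow>
    (\<exists>u. u analytic_on {p} \<and> u p \<noteq> 0 \<and> (\<forall>\<^sub>F z in nhds p. ?E u z = 0))"
  proof
    assume "unit_solution_at P Q p"
    from unit_solution_atE[OF this] obtain e0 g where e0: "e0 > 0" "g holomorphic_on ball p e0"
      "\<And>z. z \<in> ball p e0 \<Longrightarrow> g z \<noteq> 0" "\<And>z. z \<in> ball p e0 \<Longrightarrow> ode_op P Q g z = 0"
      by metis
    define e where "e = min e0 r"
    have e: "e > 0" "ball p e \<subseteq> ball p e0" "ball p e \<subseteq> ball p r" using e0(1) r(1) by (auto simp: e_def)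
    define u where "u z = g z / s z" for z
    have s': "s holomorphic_on ball p e" using s(1) e(3) by (rule holomorphic_on_subset)
    have u: "u holomorphic_on ball p e"
      unfolding u_def using e snz
      by (intro holomorphic_intros holomorphic_on_subset[OF e0(2)] s') auto
    \<comment> \<open>The powers of \<open>z - p\<close> can be cancelled only off
      \<open>p\<close>.\<close>
    have E: "?E u z = 0" if z: "z \<in> ball p e" "z \<noteq> p" for z
    proof -
      have "ode_op P Q (\<lambda>w. s w * u w) z = ode_op P Q g z"
        by (rule ode_op_cong[OF open_ball _ z(1)]) (use snz e in \<open>auto simp: u_def\<close>)
      then have "ode_op P Q (\<lambda>w. s w * u w) z = 0" using e0(4) e z by auto
      moreover have "(z - p) * ode_op P Q (\<lambda>w. s w * u w) z = (z - p) ^ n * s z ^ 3 * ?E u z"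
        by (rule ode_op_mult_sqrt[OF open_ball z(1) s' u]) (use s(2) snz e z in auto)
      ultimately have "(z - p) ^ n * s z ^ 3 * ?E u z = 0" by simp
      moreover have "s z \<noteq> 0" using snz e(3) z(1) by blast
      ultimately show ?thesis using z(2) by simp
    qed
    have "?E u z = 0" if z: "z \<in> ball p e" for z
      by (rule holomorphic_zero_at_centre[of "?E u" p e])
        (use E z e u Chol in \<open>auto intro!: holomorphic_intros intro: holomorphic_on_subset\<close>)
    then have "\<forall>\<^sub>F z in nhds p. ?E u z = 0"
      by (rule eventually_nhds_ballI[OF e(1)])
    moreover have "u analytic_on {p}" using u e(1) analytic_at_ball by blast
    moreover have "u p \<noteq> 0" using e0(3)[of p] snz[of p] e0(1) r(1) by (simp add: u_def)
    ultimately show "\<exists>u. u analytic_on {p} \<and> u p \<noteq> 0 \<and> (\<forall>\<^sub>F z in nhds p. ?E u z = 0)" by blast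
  next
    assume "\<exists>u. u analytic_on {p} \<and> u p \<noteq> 0 \<and> (\<forall>\<^sub>F z in nhds p. ?E u z = 0)"
    then obtain u where u: "u analytic_on {p}" "u p \<noteq> 0" "\<forall>\<^sub>F z in nhds p. ?E u z = 0" by blast
    obtain e0 where e0: "e0 > 0" "u holomorphic_on ball p e0"
      using u(1) by (auto simp: analytic_at_ball)
    obtain e1 where e1: "e1 > 0" "\<And>z. z \<in> ball p e1 \<Longrightarrow> ?E u z = 0"
      using u(3) unfolding eventually_nhds_metric by (auto simp: dist_commute)
    define e where "e = min (min e0 e1) r"
    have e: "e > 0" "ball p e \<subseteq> ball p e0" "ball p e \<subseteq> ball p e1" "ball p e \<subseteq> ball p r"
      using e0(1) e1(1) r(1) by (auto simp: e_def)
    have s': "s holomorphic_on ball p e" using s(1) e(4) by (rule holomorphic_on_subset)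
    have u': "u holomorphic_on ball p e" using e0(2) e(2) by (rule holomorphic_on_subset)
    let ?g = "\<lambda>z. s z * u z"
    have g: "?g holomorphic_on ball p e" by (intro holomorphic_intros s' u')
    have off: "ode_op P Q ?g z = 0" if z: "z \<in> ball p e" "z \<noteq> p" for z
    proof -
      have "(z - p) * ode_op P Q ?g z = (z - p) ^ n * s z ^ 3 * ?E u z"
        by (rule ode_op_mult_sqrt[OF open_ball z(1) s' u']) (use s(2) snz e z in auto)
      also have "\<dots> = 0" using e1(2) e z by auto
      finally show ?thesis using z(2) by simp
    qed
    have "ode_op P Q ?g z = 0" if z: "z \<in> ball p e" for z
      by (rule holomorphic_zero_at_centre[of "ode_op P Q ?g" p e])
        (use off z e g in \<open>auto intro!: holomorphic_intros\<close>)
    then have "\<forall>\<^sub>F z in nhds p. ode_op P Q ?g z = 0"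
      by (rule eventually_nhds_ballI[OF e(1)])
    moreover have "?g analytic_on {p}" using g e(1) analytic_at_ball by blast
    moreover have "?g p \<noteq> 0" using u(2) snz[of p] r(1) by simp
    ultimately show "unit_solution_at P Q p" unfolding unit_solution_at_def by blast
  qed
  then show ?thesis using frobenius_germ_iff[OF C_analytic] by simp
qed

text \<open>For \<open>k \<ge> 1\<close> the coefficient of \<open>w^(k - 2)\<close> is the
  coefficient \<open>k - 1\<close> of \<open>C\<close>; these are the \<open>b k\<close> of the
  Laine determinant.\<close>

lemma R_fun_laurent:
  defines "F \<equiv> fps_expansion C p"
  shows "(\<lambda>w. R_fun P Q (p + w)) has_laurent_expansion
    fls_shift 2 (fps_to_fls (fps_const ((1 - of_nat (Suc n) ^ 2) / 4) + fps_X * F))" (is "_ has_laurent_expansion ?G")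
proof -
  let ?a = "(1 - of_nat (Suc n) ^ 2) / 4 :: complex"
  have F: "(\<lambda>w. C (p + w)) has_fps_expansion F"
    unfolding F_def by (rule analytic_at_imp_has_fps_expansion[OF C_analytic])
  have "(\<lambda>w. ?a + w * C (p + w)) has_fps_expansion fps_const ?a + fps_X * F"
    by (intro fps_expansion_intros F)
  then have "(\<lambda>w. (?a + w * C (p + w)) * w powi (- 2)) has_laurent_expansion ?G"
    using has_laurent_expansion_shift[OF has_laurent_expansion_fps, of _ _ "- 2"] by (simp del: of_nat_Suc fps_to_fls_plus)
  moreover have "\<forall>\<^sub>F w in at 0. (?a + w * C (p + w)) * w powi (- 2) = R_fun P Q (p + w)"
  proof -
    have "\<forall>\<^sub>F w in at 0. w \<in> {w. poly P1 (p + w) \<noteq> 0} - {0}"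
      using P1_nz by (intro eventually_at_in_open open_Collect_neq continuous_intros) auto
    then show ?thesis
    proof eventually_elim
      case (elim w)
      then show ?case
        using R_fun_eq[of "p + w"]
        by (simp add: power_int_minus field_simps power2_eq_square)
    qed
  qed
  ultimately show ?thesis
    by (subst (asm) has_laurent_expansion_cong[OF _ refl]) simp_all
qed

end

section \<open>Poles of \<open>R\<close> and the Laine condition\<close>

text \<open>If the order of \<open>P\<close> at \<open>p\<close> exceeded that of \<open>Q\<close>
  by 2 or more, \<open>Q / P\<close> would have a pole of order at least 2. Hence
  \<open>(z - p)^n\<close> divides \<open>(z - p) Q\<close>.\<close>

lemma factored_ode_exists:
  assumes "P \<noteq> 0" and simple: "at_most_simple_poles (\<lambda>z. poly Q z / poly P z)"
  obtains P1 Q1 where "factored_ode P Q p (Polynomial.order p P) P1 Q1"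
proof -
  let ?X = "[:-p, 1:]" and ?n = "Polynomial.order p P"
  obtain P1 where P1: "P = ?X ^ ?n * P1" "\<not> ?X dvd P1"
    using Polynomial.order_decomp[OF \<open>P \<noteq> 0\<close>] by blast
  have P1p: "poly P1 p \<noteq> 0" using P1(2) poly_eq_0_iff_dvd by blast
  have "?X ^ ?n dvd ?X * Q"
  proof (cases "Q = 0")
    case False
    define k where "k = Polynomial.order p Q"
    obtain Q2 where Q2: "Q = ?X ^ k * Q2" "\<not> ?X dvd Q2"
      using Polynomial.order_decomp[OF False] k_def by blast
    have Q2p: "poly Q2 p \<noteq> 0" using Q2(2) poly_eq_0_iff_dvd by blast
    have "?n \<le> Suc k"
    proof (rule ccontr)
      assume "\<not> ?n \<le> Suc k"
      then have nk: "?n = k + (?n - k)" "?n - k \<ge> 2" by auto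
      have quot: "poly Q z / poly P z = (poly Q2 z / poly P1 z) / (z - p) ^ (?n - k)" if "z \<noteq> p" for z
      proof -
        have "poly P z = (z - p) ^ k * (z - p) ^ (?n - k) * poly P1 z"
          by (subst P1(1), subst nk(1)) (simp add: power_add)
        then show ?thesis using that by (subst Q2(1)) (simp add: field_simps)
      qed
      have "is_pole (\<lambda>z. (poly Q2 z / poly P1 z) / (z - p) ^ (?n - k)) p"
      proof (rule is_pole_divide)
        show "isCont (\<lambda>z. poly Q2 z / poly P1 z) p" using P1p by (intro continuous_intros) auto
        show "filterlim (\<lambda>z. (z - p) ^ (?n - k)) (at 0) (at p)"
          using nk(2) by (intro filterlim_power_diff_at_0) auto
        show "poly Q2 p / poly P1 p \<noteq> 0" using P1p Q2p by simp
      qed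
      moreover have "\<forall>\<^sub>F z in at p. poly Q z / poly P z = (poly Q2 z / poly P1 z) / (z - p) ^ (?n - k)"
        using quot by (auto simp: eventually_at_filter)
      ultimately have pole: "is_pole (\<lambda>z. poly Q z / poly P z) p"
        by (subst is_pole_cong[OF _ refl])
      have "zorder (\<lambda>z. poly Q z / poly P z) p = - int (?n - k)"
      proof (rule zorder_eqI[of "{z. poly P1 z \<noteq> 0}" _ "\<lambda>z. poly Q2 z / poly P1 z"])
        show "open {z. poly P1 z \<noteq> 0}" by (intro open_Collect_neq continuous_intros)
        show "(\<lambda>z. poly Q2 z / poly P1 z) holomorphic_on {z. poly P1 z \<noteq> 0}"
          by (intro holomorphic_intros) auto
        show "poly Q w / poly P w = poly Q2 w / poly P1 w * (w - p) powi - int (?n - k)" if "w \<noteq> p" for w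
          using quot[OF that] by (simp add: power_int_minus field_simps)
      qed (use P1p Q2p in auto)
      then show False
        using simple pole nk(2) unfolding at_most_simple_poles_def by fastforce
    qed
    then have "?X ^ ?n dvd ?X ^ Suc k" by (rule le_imp_power_dvd)
    then show ?thesis by (subst Q2(1)) (metis dvd_mult2 mult.assoc power_Suc)
  qed simp
  then obtain Q1 where "?X * Q = ?X ^ ?n * Q1" by (elim dvdE)
  then have "factored_ode P Q p ?n P1 Q1"
    using P1 P1p by unfold_locales
  then show thesis by (rule that)
qed

text \<open>For \<open>n = 0\<close> the determinant is the single entry \<open>b 1 = C p\<close>,
  which vanishes because \<open>Q1 = (z - p) Q\<close> does at \<open>p\<close>. The Frobenius
  criterion thus also yields existence at ordinary points.\<close>

lemma unit_solution_ordinary: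
  assumes "P \<noteq> 0" "at_most_simple_poles (\<lambda>z. poly Q z / poly P z)" "poly P p \<noteq> 0"
  shows "unit_solution_at P Q p"
proof -
  have n: "Polynomial.order p P = 0" using assms(3) Polynomial.order_0I by blast
  obtain P1 Q1 where "factored_ode P Q p 0 P1 Q1"
    using factored_ode_exists[OF assms(1,2), of p] unfolding n .
  then interpret factored_ode P Q p 0 P1 Q1 .
  have "poly Q1 p = 0" using arg_cong[OF Q_factor, of "\<lambda>q. poly q p"] by simp
  then have "C p = 0" by (simp add: C_def)
  then have "fps_nth (fps_expansion C p) 0 = 0"
    by (simp add: fps_expansion_def)
  then have "laine_det (Suc 0) (\<lambda>k. fps_nth (fps_expansion C p) (k - 1)) = 0"
    unfolding laine_det_eq_0_iff by (intro exI[of _ "\<lambda>_. 1"]) auto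
  then show ?thesis using unit_solution_iff by simp
qed

text \<open>The Laurent coefficients of \<open>R\<close> and the shifted Taylor coefficients of
  \<open>C\<close> are matched only from index 1 on.\<close>

lemma laine_det_cong:
  assumes "\<And>k. k \<ge> 1 \<Longrightarrow> b k = b' k"
  shows "laine_det m b = laine_det m b'"
proof -
  have "laine_matrix m b = laine_matrix m b'"
    using assms by (intro eq_matI) (auto simp: laine_matrix_def Let_def)
  then show ?thesis by (simp add: laine_det_def)
qed

text \<open>The equivalence holds point by point. At a nonroot of \<open>P\<close> both sides are
  true; at a root of order \<open>n\<close> uniqueness of the Laurent expansion forces
  \<open>m = n + 1\<close>, and the determinant is the one of the Frobenius criterion.\<close>

lemma double_satisfies_laine_iff:
  assumes "P \<noteq> 0" "at_most_simple_poles (\<lambda>z. poly Q z / poly P z)"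
  shows "double_satisfies_laine (R_fun P Q) \<longleftrightarrow> (\<forall>p. unit_solution_at P Q p)"
proof -
  have local: "(is_pole (R_fun P Q) p \<longrightarrow>
       (\<exists>(m::nat) F. m \<ge> 2 \<and>
          (\<lambda>w. R_fun P Q (p + w)) has_laurent_expansion F \<and>
          fls_subdegree F = -2 \<and>
          fls_nth F (-2) = (1 - of_nat m ^ 2) / 4 \<and>
          laine_det m (\<lambda>k. fls_nth F (int k - 2)) = 0)) \<longleftrightarrow> unit_solution_at P Q p"
    (is "(_ \<longrightarrow> ?L) \<longleftrightarrow> _") for p
  proof (cases "poly P p = 0")
    case False
    have "R_fun P Q analytic_on {p}"
      unfolding R_fun_def using False by (intro analytic_intros analytic_on_poly) auto
    then have "\<not> is_pole (R_fun P Q) p" by (rule analytic_at_imp_no_pole)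
    then show ?thesis using unit_solution_ordinary[OF assms False] by simp
  next
    case True
    define n where "n = Polynomial.order p P"
    have n: "n \<ge> 1" using True assms(1) Polynomial.order_root[of P p] by (auto simp: n_def)
    obtain P1 Q1 where "factored_ode P Q p n P1 Q1"
      using factored_ode_exists[OF assms, of p] unfolding n_def .
    then interpret factored_ode P Q p n P1 Q1 .
    define b where "b k = fps_nth (fps_expansion C p) (k - 1)" for k
    let ?a = "(1 - of_nat (Suc n) ^ 2) / 4 :: complex"
    define G where "G = fls_shift 2 (fps_to_fls (fps_const ?a + fps_X * fps_expansion C p))"
    have G: "(\<lambda>w. R_fun P Q (p + w)) has_laurent_expansion G"
      unfolding G_def by (rule R_fun_laurent)
    have G2: "fls_nth G (- 2) = ?a" by (simp add: G_def)
    have inj: "(1 - of_nat i ^ 2) / 4 = (1 - of_nat j ^ 2) / (4 :: complex) \<Longrightarrow> i = j" for i j :: nat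
    proof -
      assume "(1 - of_nat i ^ 2) / 4 = (1 - of_nat j ^ 2) / (4 :: complex)"
      then have "(of_nat (i ^ 2) :: complex) = of_nat (j ^ 2)" by simp
      then have "i ^ 2 = j ^ 2" unfolding of_nat_eq_iff .
      then show "i = j" by simp
    qed
    \<comment> \<open>Since \<open>n \<ge> 1\<close>, the double-pole coefficient is nonzero, so the
      root \<open>p\<close> of \<open>P\<close> is a genuine pole of \<open>R\<close>.\<close>
    have a: "?a \<noteq> 0" using inj[of "Suc n" 1] n by fastforce
    have sub: "fls_subdegree G = - 2"
      by (rule fls_subdegree_eqI) (use a in \<open>auto simp: G_def\<close>)
    have pole: "is_pole (R_fun P Q) p"
      using has_laurent_expansion_imp_is_pole[OF G] sub by simp
    have det: "laine_det (Suc n) (\<lambda>k. fls_nth G (int k - 2)) = laine_det (Suc n) b"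
    proof -
      have "fls_nth G (int k - 2) = b k" if "k \<ge> 1" for k
        using that by (cases k) (auto simp: G_def b_def nat_add_distrib)
      then show ?thesis by (rule laine_det_cong)
    qed
    show ?thesis
    proof
      assume "is_pole (R_fun P Q) p \<longrightarrow> ?L"
      then obtain m F where mF: "(\<lambda>w. R_fun P Q (p + w)) has_laurent_expansion F"
          "fls_nth F (-2) = (1 - of_nat m ^ 2) / 4"
          "laine_det m (\<lambda>k. fls_nth F (int k - 2)) = 0"
        using pole by blast
      have "F = G" using has_laurent_expansion_unique mF(1) G by blast
      moreover from this have "m = Suc n" using mF(2) G2 inj by metis
      ultimately show "unit_solution_at P Q p"
        using mF(3) det unfolding unit_solution_iff b_def by simp
    next
      assume "unit_solution_at P Q p"
      then have "laine_det (Suc n) b = 0" unfolding unit_solution_iff b_def .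
      then show "is_pole (R_fun P Q) p \<longrightarrow> ?L"
        using n G G2 sub det by (intro impI exI[of _ "Suc n"] exI[of _ G]) auto
    qed
  qed
  then show ?thesis unfolding double_satisfies_laine_def by blast
qed

section \<open>The Schwarzian equation\<close>

text \<open>Identity theorem for meromorphic functions. Values at isolated points may be arbitrary,
  hence the passage to \<open>remove_sings\<close> and a conclusion on punctured
  neighbourhoods.\<close>

lemma meromorphic_zero_spreads:
  assumes "T meromorphic_on UNIV" "\<exists>\<^sub>F z in at c. T z = 0"
  shows "\<forall>\<^sub>F z in at p. T z = 0"
proof -
  have sing: "isolated_singularity_at T z" for z
    using assms(1) by (meson UNIV_I meromorphic_on_isolated_singularity meromorphic_on_meromorphic_at)
  have "\<exists>\<^sub>F z in at c. remove_sings T z = 0"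
    using frequently_eventually_frequently[OF assms(2) eventually_remove_sings_eq_at[OF sing]]
    by (rule frequently_elim1) auto
  then have "remove_sings T z = 0" for z
    using frequently_eq_meromorphic_imp_constant[of "remove_sings T" 0 c UNIV]
      remove_sings_nicely_meromorphic[OF assms(1)] connected_UNIV by simp
  then show ?thesis
    using eventually_remove_sings_eq_at[OF sing, of p] by simp
qed

text \<open>With the denominators cleared, this says that a function with derivative \<open>D\<close> has
  Schwarzian derivative \<open>2 R\<close>.\<close>

definition schwarz_eq ::
  "complex poly \<Rightarrow> complex poly \<Rightarrow> (complex \<Rightarrow> complex) \<Rightarrow> complex \<Rightarrow> complex" where
  "schwarz_eq P Q D z =
     poly P z ^ 2 * (2 * D z * deriv (deriv D) z - 3 * deriv D z ^ 2)
     - D z ^ 2 * (2 * poly P z * poly (pderiv (pderiv P)) z - 3 * poly (pderiv P) z ^ 2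
                  + 4 * poly Q z * poly P z)"

text \<open>For \<open>D = P / g^2\<close> the Schwarzian and the linear equation differ by the
  factor \<open>- 4 D^3 g\<close>. This is used in both directions: from a given \<open>g\<close> to
  \<open>D\<close>, and from \<open>D\<close> to a new solution near another point.\<close>

lemma schwarz_eq_conv_ode_op:
  assumes S: "open S" "z \<in> S" and hol: "D holomorphic_on S" "g holomorphic_on S"
    and eq: "\<And>w. w \<in> S \<Longrightarrow> poly P w = D w * g w ^ 2"
  shows "schwarz_eq P Q D z = - 4 * D z ^ 3 * g z * ode_op P Q g z"
proof -
  note dD = holomorphic_has_derivs[OF hol(1) S(1)] and gD = holomorphic_has_derivs[OF hol(2) S(1)]
  have d: "deriv (\<lambda>w. D w * g w ^ 2) z = deriv D z * g z ^ 2 + 2 * D z * g z * deriv g z"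
    "deriv (deriv (\<lambda>w. D w * g w ^ 2)) z = deriv (deriv D) z * g z ^ 2 + 4 * deriv D z * g z * deriv g z
        + 2 * D z * deriv g z ^ 2 + 2 * D z * g z * deriv (deriv g) z"
    by (rule deriv_eqI_open[OF S(1) _ S(2), of _ "\<lambda>w. deriv D w * g w ^ 2 + 2 * D w * g w * deriv g w"];
        auto intro!: derivative_eq_intros dD gD S(2) simp: power2_eq_square algebra_simps)+
  have p: "deriv (poly P) z = poly (pderiv P) z" "deriv (deriv (poly P)) z = poly (pderiv (pderiv P)) z"
    by (rule deriv_eqI_open[OF S(1) _ S(2), of _ "poly (pderiv P)"]; auto intro!: poly_DERIV)+
  have ev: "\<forall>\<^sub>F w in nhds z. poly P w = D w * g w ^ 2"
    using S eq eventually_nhds by blast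
  have 1: "poly (pderiv P) z = deriv D z * g z ^ 2 + 2 * D z * g z * deriv g z"
    using deriv_cong_ev[OF ev refl] p d by simp
  have 2: "poly (pderiv (pderiv P)) z = deriv (deriv D) z * g z ^ 2 + 4 * deriv D z * g z * deriv g z
        + 2 * D z * deriv g z ^ 2 + 2 * D z * g z * deriv (deriv g) z"
    using higher_deriv_cong_ev[OF ev refl, of 2] p d by (simp add: numeral_2_eq_2)
  show ?thesis
    unfolding schwarz_eq_def ode_op_def 1 2 eq[OF S(2)]
    by (simp add: power2_eq_square power3_eq_cube algebra_simps)
qed

lemma meromorphic_on_schwarz_eq:
  assumes "D meromorphic_on UNIV"
  shows "schwarz_eq P Q D meromorphic_on UNIV"
proof -
  have poly: "poly q meromorphic_on UNIV" for q :: "complex poly"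
    by (rule analytic_on_imp_meromorphic_on[OF analytic_on_poly])
  show ?thesis
    unfolding schwarz_eq_def[abs_def] by (intro meromorphic_intros poly assms)
qed

text \<open>Leading terms at \<open>p\<close> decide: with \<open>P\<close> of order
  \<open>n\<close> and \<open>D\<close> of order \<open>k\<close> the equation gives
  \<open>(n - k) (n + k + 2) = 0\<close>, and the second factor is nonzero for natural
  numbers.\<close>

lemma (in factored_ode) schwarz_eq_order:
  assumes S: "open S" "p \<in> S" "D1 holomorphic_on S" "D1 p \<noteq> 0"
    and D: "\<And>w. w \<in> S \<Longrightarrow> D w = (w - p) ^ k * D1 w"
    and zero: "\<And>w. w \<in> S \<Longrightarrow> schwarz_eq P Q D w = 0"
  shows "k = n"
proof -
  let ?k = "of_nat k :: complex" and ?n = "of_nat n :: complex"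
  \<comment> \<open>\<open>A\<close> and \<open>B\<close> come from the two brackets of
    \<open>schwarz_eq\<close> by multiplying with \<open>(z - p)^2\<close> and removing the powers
    of \<open>z - p\<close> contributed by \<open>D\<close> and \<open>P\<close>, so
    \<open>E\<close> is continuous at \<open>p\<close>.\<close>
  define A where "A z = 2 * D1 z * (?k * (?k - 1) * D1 z + 2 * ?k * (z - p) * deriv D1 z + (z - p) ^ 2 * deriv (deriv D1) z)
     - 3 * (?k * D1 z + (z - p) * deriv D1 z) ^ 2" for z
  define B where "B z = 2 * poly P1 z * (?n * (?n - 1) * poly P1 z
       + 2 * ?n * (z - p) * poly (pderiv P1) z + (z - p) ^ 2 * poly (pderiv (pderiv P1)) z)
       - 3 * (?n * poly P1 z + (z - p) * poly (pderiv P1) z) ^ 2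
       + 4 * (z - p) * poly Q1 z * poly P1 z" for z
  define E where "E z = poly P1 z ^ 2 * A z - D1 z ^ 2 * B z" for z
  note dD = holomorphic_has_derivs[OF S(3,1)]
  have E0: "E z = 0" if z: "z \<in> S" "z \<noteq> p" for z
  proof -
    have S': "open (S - {p})" "z \<in> S - {p}" using S z by auto
    define d where "d = z - p"
    have d0: "d \<noteq> 0" using z by (simp add: d_def)
    have pow_mult: "((\<lambda>x. (x - p) ^ k * F x) has_field_derivative (w - p) ^ k * (?k * F w / (w - p) + F')) (at w)"
      if "(F has_field_derivative F') (at w)" "w \<noteq> p" for F F' w
    proof -
      have "of_nat k * (w - p) ^ (k - Suc 0) = of_nat k * (w - p) ^ k / (w - p)"
        using that(2) by (cases k) auto
      then show ?thesis
        using that by (auto intro!: derivative_eq_intros simp: field_simps)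
    qed
    have d1: "deriv D z = d ^ k * (?k * D1 z / d + deriv D1 z)"
      "deriv (deriv D) z = d ^ k * (?k * (?k * D1 z / d + deriv D1 z) / d
          + (?k * deriv D1 z / d - ?k * D1 z / d ^ 2 + deriv (deriv D1) z))"
    proof -
      have Dd: "(D has_field_derivative (w - p) ^ k * (?k * D1 w / (w - p) + deriv D1 w)) (at w)"
        if w: "w \<in> S - {p}" for w
      proof (rule DERIV_cong_ev[THEN iffD2, OF refl _ refl])
        show "\<forall>\<^sub>F x in nhds w. D x = (x - p) ^ k * D1 x"
          using D S(1) w eventually_nhds by blast
        show "((\<lambda>x. (x - p) ^ k * D1 x) has_field_derivative
            (w - p) ^ k * (?k * D1 w / (w - p) + deriv D1 w)) (at w)"
          using w dD by (intro pow_mult) auto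
      qed
      have "((\<lambda>w. ?k * D1 w / (w - p) + deriv D1 w) has_field_derivative
          ((?k * deriv D1 z * d - ?k * D1 z) / (d * d) + deriv (deriv D1) z)) (at z)"
        using z by (auto intro!: derivative_eq_intros dD simp: d_def)
      moreover have "(?k * deriv D1 z * d - ?k * D1 z) / (d * d) = ?k * deriv D1 z / d - ?k * D1 z / d ^ 2"
        using d0 by (simp add: field_simps power2_eq_square)
      ultimately have "((\<lambda>w. ?k * D1 w / (w - p) + deriv D1 w) has_field_derivative
          (?k * deriv D1 z / d - ?k * D1 z / d ^ 2 + deriv (deriv D1) z)) (at z)" by simp
      note Dd2 = pow_mult[OF this z(2), folded d_def]
      show "deriv D z = d ^ k * (?k * D1 z / d + deriv D1 z)"
        "deriv (deriv D) z = d ^ k * (?k * (?k * D1 z / d + deriv D1 z) / d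
          + (?k * deriv D1 z / d - ?k * D1 z / d ^ 2 + deriv (deriv D1) z))"
        using deriv_eqI_open[OF S'(1) Dd S'(2)] Dd2 by (auto simp: d_def)
    qed
    have e1: "d * deriv D z = d ^ k * (?k * D1 z + d * deriv D1 z)"
      unfolding d1(1) using d0 by (simp add: field_simps)
    have e2: "d ^ 2 * deriv (deriv D) z = d ^ k * (?k * (?k - 1) * D1 z + 2 * ?k * d * deriv D1 z
        + d ^ 2 * deriv (deriv D1) z)"
      unfolding d1(2) using d0 by (simp add: field_simps power2_eq_square)
    have "0 = d ^ 2 * schwarz_eq P Q D z" using zero z by simp
    also have "\<dots> = poly P z ^ 2 * (2 * D z * (d ^ 2 * deriv (deriv D) z) - 3 * (d * deriv D z) ^ 2)
      - D z ^ 2 * (2 * poly P z * (d ^ 2 * poly (pderiv (pderiv P)) z)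
        - 3 * (d * poly (pderiv P) z) ^ 2 + 4 * d * (d * poly Q z) * poly P z)"
      unfolding schwarz_eq_def by (simp add: power_mult_distrib algebra_simps power2_eq_square)
    also have "\<dots> = (d ^ n * d ^ k) ^ 2 * E z"
      unfolding e1 e2 poly_pderiv_P[of z, folded d_def] poly_pderiv2_P[of z, folded d_def]
        poly_Q[of z, folded d_def] poly_P[of z, folded d_def] D[OF z(1), folded d_def]
        E_def A_def B_def d_def[symmetric]
      by (simp add: power_mult_distrib algebra_simps power2_eq_square)
    finally show ?thesis using d0 by simp
  qed
  have "continuous_on S E"
    unfolding E_def A_def B_def
    using S by (intro holomorphic_on_imp_continuous_on holomorphic_intros)
  then have "isCont E p" using S(1,2) by (simp add: continuous_on_eq_continuous_at)
  then have "(E \<longlongrightarrow> E p) (at p)" by (simp add: isCont_def)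
  moreover have "\<forall>\<^sub>F z in at p. E z = 0"
    using eventually_at_in_open[OF S(1,2)] by eventually_elim (use E0 in auto)
  then have "(E \<longlongrightarrow> 0) (at p)" using tendsto_eventually by blast
  ultimately have "E p = 0" using tendsto_unique[of "at p"] by auto
  moreover have "E p = (poly P1 p * D1 p) ^ 2 * ((?n - ?k) * (?n + ?k + 2))"
    unfolding E_def A_def B_def by (simp add: power2_eq_square algebra_simps)
  ultimately have "(?n - ?k) * (?n + ?k + 2) = 0" using P1_nz S(4) by simp
  moreover have "?n + ?k + 2 \<noteq> 0"
  proof -
    have "?n + ?k + 2 = of_nat (n + k + 2)" by simp
    then show ?thesis by (metis of_nat_eq_0_iff add_2_eq_Suc' nat.distinct(1))
  qed
  ultimately show "k = n" by simp
qed

section \<open>From a meromorphic primitive to nonvanishing local solutions\<close>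

text \<open>The Schwarzian equation for \<open>H'\<close> holds on \<open>S\<close> and spreads to a
  neighbourhood of \<open>p\<close>. There it forces \<open>H'\<close> to have the order of
  \<open>P\<close>, so \<open>P / H'\<close> extends without zeros and its square root is the
  solution.\<close>

lemma unit_solution_of_finite_primitive:
  assumes P: "P \<noteq> 0" "at_most_simple_poles (\<lambda>z. poly Q z / poly P z)"
    and H: "H meromorphic_on UNIV" "\<not> is_pole H p"
    and S: "open S" "S \<noteq> {}" "g holomorphic_on S"
      "\<And>z. z \<in> S \<Longrightarrow> g z \<noteq> 0" "\<And>z. z \<in> S \<Longrightarrow> poly P z \<noteq> 0" "\<And>z. z \<in> S \<Longrightarrow> ode_op P Q g z = 0"
    and prim: "\<And>z. z \<in> S \<Longrightarrow> (H has_field_derivative poly P z / (g z)\<^sup>2) (at z)"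
  shows "unit_solution_at P Q p"
proof -
  \<comment> \<open>\<open>H\<close> may have wrong values at removable singularities, possibly at
    \<open>p\<close>; \<open>remove_sings\<close> makes \<open>D\<close> analytic there.\<close>
  define D where "D = deriv (remove_sings H)"
  have mero: "D meromorphic_on UNIV" "schwarz_eq P Q D meromorphic_on UNIV"
    using H(1) by (auto simp: D_def intro!: meromorphic_intros meromorphic_on_schwarz_eq)
  have "H analytic_on S"
    using prim S(1) by (metis analytic_on_open holomorphic_on_open)
  then have anH: "H analytic_on {z}" if "z \<in> S" for z
    using that by (meson analytic_on_analytic_at)
  have D_S: "D z = poly P z / (g z)\<^sup>2" if "z \<in> S" for z
    unfolding D_def using anH[OF that] DERIV_imp_deriv[OF prim[OF that]] by simp
  have D_hol: "D holomorphic_on S"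
    unfolding D_def using \<open>H analytic_on S\<close> S(1)
    by (intro holomorphic_deriv analytic_imp_holomorphic remove_sings_analytic_on)
  obtain c where c: "c \<in> S" using S(2) by blast
  have inS: "\<forall>\<^sub>F z in at c. z \<in> S"
    using eventually_at_in_open'[OF S(1) c] .
  have "schwarz_eq P Q D z = 0" if z: "z \<in> S" for z
  proof -
    have "schwarz_eq P Q D z = - 4 * D z ^ 3 * g z * ode_op P Q g z"
      by (rule schwarz_eq_conv_ode_op[OF S(1) z D_hol S(3)]) (use S(4) in \<open>simp add: D_S\<close>)
    then show ?thesis using S(6)[OF z] by simp
  qed
  then have "\<forall>\<^sub>F z in at c. schwarz_eq P Q D z = 0"
    using inS by (auto elim: eventually_mono)
  then have "\<exists>\<^sub>F z in at c. schwarz_eq P Q D z = 0"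
    by (intro eventually_frequently) simp_all
  then have schw: "\<forall>\<^sub>F z in at p. schwarz_eq P Q D z = 0"
    by (rule meromorphic_zero_spreads[OF mero(2)])
  \<comment> \<open>\<open>D\<close> is nonzero on \<open>S\<close>, so it cannot vanish identically
    near \<open>p\<close>; this gives it a finite order at \<open>p\<close>.\<close>
  have "\<not> (\<exists>\<^sub>F z in at p. D z = 0)"
  proof
    assume "\<exists>\<^sub>F z in at p. D z = 0"
    then have "\<forall>\<^sub>F z in at c. D z = 0" by (rule meromorphic_zero_spreads[OF mero(1)])
    then have "\<forall>\<^sub>F z in at c. False"
      using inS by eventually_elim (use D_S S(4,5) in auto)
    then show False by simp
  qed
  then have D_nz: "\<forall>\<^sub>F z in at p. D z \<noteq> 0" by (simp add: frequently_def)
  have "\<exists>l. (H \<longlongrightarrow> l) (at p)"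
    using H by (meson UNIV_I meromorphic_on_meromorphic_at meromorphic_on_not_essential not_essential_def)
  then have "remove_sings H analytic_on {p}"
    using remove_sings_analytic_at H(1)
    by (meson UNIV_I meromorphic_on_isolated_singularity meromorphic_on_meromorphic_at)
  then have "D analytic_on {p}" unfolding D_def by (rule analytic_deriv)
  then obtain r where r: "r > 0" "D holomorphic_on ball p r"
    by (auto simp: analytic_at_ball)
  obtain r' where r': "r' > 0" "\<And>z. z \<in> ball p r' \<Longrightarrow> z \<noteq> p \<Longrightarrow> schwarz_eq P Q D z = 0 \<and> D z \<noteq> 0"
    using eventually_conj[OF schw D_nz] unfolding eventually_at by (auto simp: dist_commute)
  define k where "k = nat (zorder D p)"
  define D1 where "D1 = zor_poly D p"
  have "\<exists>w\<in>ball p r. D w \<noteq> 0"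
  proof -
    have "\<forall>\<^sub>F z in at p. z \<in> ball p r" using r(1) by (intro eventually_at_in_open') auto
    then have "\<forall>\<^sub>F z in at p. z \<in> ball p r \<and> D z \<noteq> 0" using D_nz by (rule eventually_conj)
    then show ?thesis using eventually_happens by fastforce
  qed
  then have "\<exists>r1>0. cball p r1 \<subseteq> ball p r \<and> D1 holomorphic_on cball p r1 \<and>
      (\<forall>w\<in>cball p r1. D w = D1 w * (w - p) ^ k \<and> D1 w \<noteq> 0)"
    using zorder_exist_zero[OF r(2) open_ball connected_ball, of p] r(1)
    unfolding k_def D1_def by simp
  then obtain r1 where r1: "r1 > 0" "D1 holomorphic_on cball p r1"
    "\<And>w. w \<in> cball p r1 \<Longrightarrow> D w = D1 w * (w - p) ^ k \<and> D1 w \<noteq> 0" "cball p r1 \<subseteq> ball p r"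
    by blast
  define n where "n = Polynomial.order p P"
  obtain P1 Q1 where "factored_ode P Q p n P1 Q1"
    using factored_ode_exists[OF P, of p] unfolding n_def .
  then interpret factored_ode P Q p n P1 Q1 .
  have "\<exists>r2>0. \<forall>z\<in>ball p r2. poly P1 z \<noteq> 0"
  proof -
    have "open {z \<in> UNIV. poly P1 z \<noteq> 0}" by (rule open_nonroots[OF open_UNIV])
    then show ?thesis using P1_nz by (force simp: open_contains_ball)
  qed
  then obtain r2 where r2: "r2 > 0" "\<And>z. z \<in> ball p r2 \<Longrightarrow> poly P1 z \<noteq> 0" by blast
  define e where "e = min (min r r') (min r1 r2)"
  have e: "e > 0" "ball p e \<subseteq> ball p r" "ball p e \<subseteq> ball p r'" "ball p e \<subseteq> cball p r1" "ball p e \<subseteq> ball p r2"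
    using r r' r1 r2 by (auto simp: e_def)
  have D1: "D1 holomorphic_on ball p e" using r1(2) e(4) by (rule holomorphic_on_subset)
  have De: "D holomorphic_on ball p e" using r(2) e(2) by (rule holomorphic_on_subset)
  have schw_e: "schwarz_eq P Q D z = 0" if "z \<in> ball p e" for z
  proof (rule holomorphic_zero_at_centre[of "schwarz_eq P Q D" p e])
    show "schwarz_eq P Q D holomorphic_on ball p e"
      unfolding schwarz_eq_def[abs_def] by (intro holomorphic_intros De) auto
  qed (use r' e that in auto)
  have "k = n"
    by (rule schwarz_eq_order[of "ball p e" D1 D k]) (use e r1(1) r1(3)[of p] r1(3) D1 schw_e in \<open>auto simp: mult.commute\<close>)
  \<comment> \<open>Since \<open>k = n\<close>, this quotient is \<open>P / D\<close> with the
    common power of \<open>z - p\<close> cancelled.\<close>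
  have "(\<lambda>z. poly P1 z / D1 z) holomorphic_on ball p e"
    using D1 r1(3) e(4) by (intro holomorphic_intros) auto
  then obtain g0 where g0: "g0 holomorphic_on ball p e" "\<And>z. z \<in> ball p e \<Longrightarrow> poly P1 z / D1 z = g0 z ^ 2"
    by (rule contractible_imp_holomorphic_sqrt[OF _ convex_imp_contractible[OF convex_ball]])
      (use r1(3) r2(2) e in auto)
  have g0nz: "g0 z \<noteq> 0" if "z \<in> ball p e" for z
    using g0(2)[OF that] r1(3)[OF subsetD[OF e(4) that]] r2(2)[OF subsetD[OF e(5) that]] by auto
  have PD: "poly P z = D z * g0 z ^ 2" if "z \<in> ball p e" for z
    using g0(2)[OF that] r1(3)[OF subsetD[OF e(4) that]] \<open>k = n\<close> by (simp add: poly_P field_simps)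
  have off: "ode_op P Q g0 z = 0" if z: "z \<in> ball p e" "z \<noteq> p" for z
  proof -
    have "- 4 * D z ^ 3 * g0 z * ode_op P Q g0 z = 0"
      using schwarz_eq_conv_ode_op[OF open_ball z(1) De g0(1) PD] schw_e[OF z(1)] by simp
    moreover have "D z \<noteq> 0" using r'(2) e z by auto
    ultimately show ?thesis using g0nz[OF z(1)] by simp
  qed
  have "ode_op P Q g0 z = 0" if z: "z \<in> ball p e" for z
    by (rule holomorphic_zero_at_centre[of "ode_op P Q g0" p e])
      (use off z e g0 in \<open>auto intro!: holomorphic_intros\<close>)
  then have "\<forall>\<^sub>F z in nhds p. ode_op P Q g0 z = 0"
    by (rule eventually_nhds_ballI[OF e(1)])
  moreover have "g0 analytic_on {p}" using g0(1) e(1) analytic_at_ball by blast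
  ultimately show ?thesis
    unfolding unit_solution_at_def using g0nz[of p] e(1) by auto
qed

lemma unit_solution_of_primitive:
  assumes P: "P \<noteq> 0" "at_most_simple_poles (\<lambda>z. poly Q z / poly P z)"
    and H: "H meromorphic_on UNIV"
    and S: "open S" "S \<noteq> {}" "g holomorphic_on S"
      "\<And>z. z \<in> S \<Longrightarrow> g z \<noteq> 0" "\<And>z. z \<in> S \<Longrightarrow> poly P z \<noteq> 0" "\<And>z. z \<in> S \<Longrightarrow> ode_op P Q g z = 0"
    and prim: "\<And>z. z \<in> S \<Longrightarrow> (H has_field_derivative poly P z / (g z)\<^sup>2) (at z)"
  shows "unit_solution_at P Q p"
proof (cases "is_pole H p")
  case False
  then show ?thesis using unit_solution_of_finite_primitive[OF P H _ S prim] by blast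
next
  case True
  \<comment> \<open>Replace the primitive H of P / g^2 by the primitive - 1 / H of P / (g H)^2.\<close>
  have Hhol: "H holomorphic_on S" using prim S(1) by (metis holomorphic_on_open)
  obtain c where c: "c \<in> S" using S(2) by blast
  define S' where "S' = {z \<in> S. H z \<noteq> 0}"
  have "open S'"
    unfolding S'_def using continuous_open_preimage[OF holomorphic_on_imp_continuous_on[OF Hhol] S(1), of "- {0}"]
    by (auto simp: vimage_def Int_def)
  \<comment> \<open>If \<open>H\<close> vanished on all of \<open>S\<close>, its derivative
    \<open>P / g^2\<close> would be zero at \<open>c\<close>.\<close>
  moreover have "S' \<noteq> {}"
  proof
    assume "S' = {}"
    then have "\<forall>\<^sub>F z in nhds c. H z = 0"
      unfolding eventually_nhds S'_def using c S(1) by blast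
    then have "deriv H c = deriv (\<lambda>_. 0) c" by (rule deriv_cong_ev) simp
    then have "poly P c / (g c)\<^sup>2 = 0" using DERIV_imp_deriv[OF prim[OF c]] by simp
    then show False using S(4,5) c by simp
  qed
  moreover have "(\<lambda>z. - 1 / H z) meromorphic_on UNIV"
    using H by (intro meromorphic_intros)
  moreover have "\<not> is_pole (\<lambda>z. - 1 / H z) p"
  proof
    assume pole: "is_pole (\<lambda>z. - 1 / H z) p"
    have "((\<lambda>z. - 1 * inverse (H z)) \<longlongrightarrow> - 1 * 0) (at p)"
      using True unfolding is_pole_def
      by (intro tendsto_mult tendsto_const filterlim_compose[OF tendsto_inverse_0])
    then show False
      using pole not_tendsto_and_filterlim_at_infinity[of "at p"] unfolding is_pole_def
      by (auto simp: divide_inverse)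
  qed
  \<comment> \<open>By reduction of order \<open>g H\<close> is a solution, so it can take the place
    of \<open>g\<close> when \<open>- 1 / H\<close> takes that of \<open>H\<close>.\<close>
  moreover have "(\<lambda>z. g z * H z) holomorphic_on S'" "\<And>z. z \<in> S' \<Longrightarrow> ode_op P Q (\<lambda>z. g z * H z) z = 0"
    using second_solution[OF S(1,3,4,6) prim] by (auto simp: S'_def intro: holomorphic_on_subset)
  moreover have "((\<lambda>z. - 1 / H z) has_field_derivative poly P z / (g z * H z)\<^sup>2) (at z)" if "z \<in> S'" for z
    using that S(4) unfolding S'_def
    by (auto intro!: derivative_eq_intros prim simp: field_simps power2_eq_square)
  ultimately show ?thesis
    using S by (intro unit_solution_of_finite_primitive[OF P, of "\<lambda>z. - 1 / H z" p S' "\<lambda>z. g z * H z"])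
      (auto simp: S'_def)
qed

section \<open>The equivalence\<close>

lemma local_solutionD:
  assumes "local_solution P Q a r g"
  shows "r > 0" "\<And>z. z \<in> ball a r \<Longrightarrow> poly P z \<noteq> 0" "g holomorphic_on ball a r"
    "\<And>z. z \<in> ball a r \<Longrightarrow> ode_op P Q g z = 0"
proof -
  show "r > 0" "g holomorphic_on ball a r" and P: "\<And>z. z \<in> ball a r \<Longrightarrow> poly P z \<noteq> 0"
    using assms by (auto simp: local_solution_def)
  fix z assume z: "z \<in> ball a r"
  have "deriv (deriv g) z - poly (pderiv P) z / poly P z * deriv g z + poly Q z / poly P z * g z = 0"
    using assms z by (auto simp: local_solution_def)
  moreover have "ode_op P Q g z = poly P z *
      (deriv (deriv g) z - poly (pderiv P) z / poly P z * deriv g z + poly Q z / poly P z * g z)"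
    using P[OF z] by (simp add: ode_op_def field_simps)
  ultimately show "ode_op P Q g z = 0" by simp
qed

lemma local_solutionI:
  assumes "r > 0" "\<And>z. z \<in> ball a r \<Longrightarrow> poly P z \<noteq> 0" "g holomorphic_on ball a r"
    "\<And>z. z \<in> ball a r \<Longrightarrow> ode_op P Q g z = 0"
  shows "local_solution P Q a r g"
  unfolding local_solution_def
proof (intro conjI ballI assms)
  fix z assume z: "z \<in> ball a r"
  have "ode_op P Q g z = poly P z *
      (deriv (deriv g) z - poly (pderiv P) z / poly P z * deriv g z + poly Q z / poly P z * g z)"
    using assms(2)[OF z] by (simp add: ode_op_def field_simps)
  then show "deriv (deriv g) z - poly (pderiv P) z / poly P z * deriv g z + poly Q z / poly P z * g z = 0"
    using assms(2,4)[OF z] by simp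
qed

theorem theorem3p5:
  fixes P Q :: "complex poly"
  assumes "P \<noteq> 0"
    and "at_most_simple_poles (\<lambda>z. poly Q z / poly P z)"
  defines "cond_i \<equiv>
      (\<exists>a r g. local_solution P Q a r g \<and> (\<exists>z\<in>ball a r. g z \<noteq> 0) \<and>
        (\<exists>c s G. ball c s \<subseteq> ball a r \<and> local_primitive P g c s G \<and>
          (\<exists>H. H meromorphic_on UNIV \<and> extends_from_ball H c s G)))"
    and "cond_ii \<equiv> double_satisfies_laine (R_fun P Q)"
    and "cond_iii \<equiv>
      (\<forall>a r g. local_solution P Q a r g \<longrightarrow>
        (\<exists>h. h holomorphic_on UNIV \<and> extends_from_ball h a r g) \<and>
        (\<forall>h. h holomorphic_on UNIV \<and> extends_from_ball h a r g \<and> (\<exists>z. h z \<noteq> 0) \<longrightarrow>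
          has_meromorphic_primitive P h))"
  shows "(cond_i \<longleftrightarrow> cond_ii) \<and> (cond_ii \<longleftrightarrow> cond_iii)"
proof -
  have ii: "cond_ii \<longleftrightarrow> (\<forall>p. unit_solution_at P Q p)"
    unfolding cond_ii_def by (rule double_satisfies_laine_iff[OF assms(1,2)])
  \<comment> \<open>(i) implies the local criterion: \<open>H\<close> agrees with \<open>G\<close>
    on an open ball and so has the same derivative there.\<close>
  have "unit_solution_at P Q p" if i: cond_i for p
  proof -
    obtain a r g c s G H where 1: "local_solution P Q a r g" "ball c s \<subseteq> ball a r"
      "local_primitive P g c s G" "H meromorphic_on UNIV" "extends_from_ball H c s G"
      using i unfolding cond_i_def by blast
    note sol = local_solutionD[OF 1(1)]
    have s: "s > 0" "\<And>z. z \<in> ball c s \<Longrightarrow> g z \<noteq> 0"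
      "\<And>z. z \<in> ball c s \<Longrightarrow> (G has_field_derivative poly P z / (g z)\<^sup>2) (at z)"
      using 1(3) by (auto simp: local_primitive_def)
    have H: "(H has_field_derivative poly P z / (g z)\<^sup>2) (at z)" if "z \<in> ball c s" for z
      using has_field_derivative_transform_within_open[OF s(3)[OF that] open_ball that] 1(5)
      by (simp add: extends_from_ball_def)
    show ?thesis
      by (rule unit_solution_of_primitive[OF assms(1,2) 1(4), of "ball c s" g])
        (use s sol 1(2) H in \<open>auto intro: holomorphic_on_subset\<close>)
  qed
  \<comment> \<open>The local criterion implies (iii): solutions extend, the extension satisfies the
    equation everywhere, and so it has a primitive.\<close>
  moreover have cond_iii if unit: "\<And>p. unit_solution_at P Q p"
    unfolding cond_iii_def
  proof (intro allI impI conjI)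
    fix a r g assume "local_solution P Q a r g"
    note sol = local_solutionD[OF this]
    show "\<exists>h. h holomorphic_on UNIV \<and> extends_from_ball h a r g"
      using solution_extends[OF unit assms(1) sol(3,1,4)] unfolding extends_from_ball_def by metis
    fix h assume h: "h holomorphic_on UNIV \<and> extends_from_ball h a r g \<and> (\<exists>z. h z \<noteq> 0)"
    have "ode_op P Q h z = 0" if "z \<in> ball a r" for z
      using ode_op_cong[OF open_ball _ that, of h g] h sol(4)[OF that] by (simp add: extends_from_ball_def)
    then have "ode_op P Q h z = 0" for z
      using solution_on_UNIV[of h "ball a r"] h sol(1) by auto
    then show "has_meromorphic_primitive P h"
      using solution_has_primitive[OF unit assms(1)] h by blast
  qed
  \<comment> \<open>(iii) implies (i): a nonvanishing solution at an ordinary point \<open>a\<close>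
    keeps (iii) from being applied vacuously. One \<open>G\<close> then serves as local primitive
    and as its own meromorphic extension.\<close>
  moreover have cond_i if iii: cond_iii
  proof -
    obtain a where a: "poly P a \<noteq> 0"
      using nonroot_exists[OF open_UNIV UNIV_not_empty assms(1)] by blast
    obtain e0 g where g: "e0 > 0" "g holomorphic_on ball a e0"
      "\<And>z. z \<in> ball a e0 \<Longrightarrow> g z \<noteq> 0" "\<And>z. z \<in> ball a e0 \<Longrightarrow> ode_op P Q g z = 0"
      using unit_solution_atE[OF unit_solution_ordinary[OF assms(1,2) a]] by metis
    obtain e where e: "e > 0" "ball a e \<subseteq> {z \<in> ball a e0. poly P z \<noteq> 0}"
      by (rule openE[OF open_nonroots[OF open_ball], of a a e0 P]) (use a g(1) in auto)
    have "ball a e \<subseteq> ball a e0" using e(2) by blast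
    with g(2) have "g holomorphic_on ball a e" by (rule holomorphic_on_subset)
    then have sol: "local_solution P Q a e g"
      by (intro local_solutionI) (use e g in auto)
    then obtain h where h: "h holomorphic_on UNIV" "extends_from_ball h a e g"
      using iii unfolding cond_iii_def by blast
    have hg: "h z = g z" "g z \<noteq> 0" if "z \<in> ball a e" for z
      using h(2) that e(2) g(3) by (auto simp: extends_from_ball_def)
    then have "\<exists>z. h z \<noteq> 0" using e(1) by (metis centre_in_ball)
    then have "has_meromorphic_primitive P h"
      using iii sol h unfolding cond_iii_def by blast
    then obtain G where G: "G meromorphic_on UNIV"
      "\<And>z. h z \<noteq> 0 \<Longrightarrow> (G has_field_derivative poly P z / (h z)\<^sup>2) (at z)"
      unfolding has_meromorphic_primitive_def by blast
    have "local_primitive P g a e G"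
      unfolding local_primitive_def
    proof (intro conjI ballI e(1))
      fix z assume "z \<in> ball a e"
      note z = hg[OF this]
      show "g z \<noteq> 0" by (rule z(2))
      show "(G has_field_derivative poly P z / (g z)\<^sup>2) (at z)" using G(2)[of z] z by simp
    qed
    moreover have "\<exists>z\<in>ball a e. g z \<noteq> 0"
      using hg(2)[of a] e(1) by (intro bexI[of _ a]) auto
    ultimately show ?thesis
      unfolding cond_i_def extends_from_ball_def using sol G(1) by blast
  qed
  ultimately show ?thesis using ii by blast
qed

end
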